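(* Let $k$ be a field (of arbitrary characteristic), let $X=\operatorname{Spec}k[S]$ be a not necessarily normal affine toric variety, where $S\subset M$ is an affine monoid spanning $M$, and let $E\subset S$ be a finite generating set of $S$. For every $u\in M$ we have $$(T^1_X)_u\cong\Bigl(L_k(E^u_S)\big/\langle q\in L(E^u_S)\mid\bar q+u\notin S\rangle_k\Bigr)^*.$$ Moreover, for $w\in S$, multiplication with $\chi^w$ from $(T^1_X)_u$ to $(T^1_X)_{u+w}$ corresponds to the natural linear map $$\Bigl(L_k(E^u_S)\big/\langle q\in L(E^u_S)\mid\bar q+u\notin S\rangle_k\Bigr)^*\to\Bigl(L_k(E^{u+w}_S)\big/\langle q\in L(E^{u+w}_S)\mid\bar q+u+w\notin S\rangle_k\Bigr)^*$$ which is induced by the restriction of a linear form on $L_k(E^u_S)$ to $L_k(E^{u+w}_S)\subset L_k(E^u_S)$. In particular, $\chi^w$ annihilates those elements of $(T^1_X)_u$ which correspond to linear forms that vanish on $L_k(E^{u+w}_S)$.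
   Context: An affine monoid is a finitely generated submonoid $S$ of a lattice $M$; here $S$ spans $M$ as an abelian group. $k[S]$ has $k$-basis $\chi^w$, $w\in S$. For any subset $F\subset M$ and $u\in M$: $F^u_S=\{w\in F\mid u+w\notin S\}$. Relations: for a finite set $F=\{w_1,\dots,w_r\}\subset M$ let $\pi:\mathbb Z^r\to M$, $e_i\mapsto w_i$; $L(F)=\ker\pi$ and $L_k(F)=\ker(\pi\otimes k)$. For $F'\subset F$ we regard $L_k(F')\subset L_k(F)$ (extension by zero). Every $q\in L(F)$ is uniquely $q=q^+-q^-$ with $q^\pm\in\mathbb Z^r_{\ge0}$ of disjoint supports, and $\bar q:=\pi(q^+)=\pi(q^-)$. For $G\subset L(F)$, $\langle G\rangle_k\subset L_k(F)$ denotes its $k$-span. $(-)^*$ is the dual $k$-vector space. $T^1$: write $A=k[S]=R/I$ with $R=k[z_1,\dots,z_r]$, $z_i\mapsto\chi^{w_i}$ for a finite generating set $\{w_1,\dots,w_r\}$ of $S$. Then $T^1_X=\operatorname{Hom}_A(I/I^2,A)/D$ with $D$ the $A$-submodule generated by the homomorphisms $\partial_i:f\mapsto\partial f/\partial z_i$; it is independent of the presentation up to isomorphism and $M$-graded ($\deg\chi^w=w$, $\deg z_i=w_i$; a homomorphism of degree $u$ maps degree $d$ to degree $d+u$). $(T^1_X)_u$ is the component of degree $u$. *)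

theory Defs
  imports
    Complex_Main
    "HOL-Library.Poly_Mapping"
    "HOL-Library.Function_Algebras"
    "HOL-Computational_Algebra.Group_Closure"
begin

section \<open>Lattices, affine monoids, monoid algebras\<close>

text \<open>
  The lattice \<open>M\<close> is a type \<open>'m::ab_group_add\<close> that has a finite basis over the integers.
  Elements of \<open>\<int>\<^sup>F\<close> for \<open>F \<subseteq> M\<close> are the finitely supported functions \<open>'m \<Rightarrow>\<^sub>0 int\<close> with keys
  in \<open>F\<close>; extension by zero is then invisible. The same convention is used for \<open>k\<^sup>F\<close> and \<open>\<nat>\<^sup>F\<close>.
\<close>

definition zmult :: "int \<Rightarrow> 'm::ab_group_add \<Rightarrow> 'm" where
  "zmult n x = (if 0 \<le> n then ((+) x ^^ nat n) 0 else - (((+) x ^^ nat (- n)) 0))"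

definition proj :: "('m::ab_group_add \<Rightarrow>\<^sub>0 int) \<Rightarrow> 'm" where
  "proj c = (\<Sum>w\<in>Poly_Mapping.keys c. zmult (Poly_Mapping.lookup c w) w)"

definition lattice_basis :: "'m::ab_group_add set \<Rightarrow> bool" where
  "lattice_basis B \<longleftrightarrow> finite B \<and> (\<forall>x. \<exists>!c. Poly_Mapping.keys c \<subseteq> B \<and> proj c = x)"

definition add_submonoid :: "'m::ab_group_add set \<Rightarrow> bool" where
  "add_submonoid S \<longleftrightarrow> 0 \<in> S \<and> (\<forall>x\<in>S. \<forall>y\<in>S. x + y \<in> S)"

text \<open>The monoid algebra \<open>k[S]\<close> lives inside the group algebra \<open>k[M]\<close>, which is the type
  \<open>'m \<Rightarrow>\<^sub>0 'k\<close> with its convolution product.\<close>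

definition monoid_alg :: "'m::ab_group_add set \<Rightarrow> ('m \<Rightarrow>\<^sub>0 'k::field) set" where
  "monoid_alg S = {f. Poly_Mapping.keys f \<subseteq> S}"

abbreviation chi :: "'m::ab_group_add \<Rightarrow> 'm \<Rightarrow>\<^sub>0 'k::field" where
  "chi w \<equiv> Poly_Mapping.single w 1"

definition kscale :: "'k::field \<Rightarrow> ('m \<Rightarrow>\<^sub>0 'k) \<Rightarrow> ('m \<Rightarrow>\<^sub>0 'k)" where
  "kscale c f = Poly_Mapping.map ((*) c) f"

lemma lookup_kscale [simp]:
  "Poly_Mapping.lookup (kscale c f) x = c * Poly_Mapping.lookup f x"
  by (simp add: kscale_def Poly_Mapping.map.rep_eq when_def)

interpretation kvs: vector_space "kscale :: 'k::field \<Rightarrow> ('m \<Rightarrow>\<^sub>0 'k) \<Rightarrow> ('m \<Rightarrow>\<^sub>0 'k)"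
  by unfold_locales
    (auto intro!: poly_mapping_eqI simp: Poly_Mapping.lookup_add algebra_simps)

section \<open>Quotients by subgroups\<close>

definition coset :: "'a::ab_group_add set \<Rightarrow> 'a \<Rightarrow> 'a set" where
  "coset V x = (+) x ` V"

definition quot :: "'a::ab_group_add set \<Rightarrow> 'a set \<Rightarrow> 'a set set" where
  "quot U V = coset V ` U"

text \<open>Operations on cosets. The unions range over all representatives; when the operation
  is well defined they are unions of one and the same coset.\<close>

definition qadd :: "'a::ab_group_add set \<Rightarrow> 'a set \<Rightarrow> 'a set \<Rightarrow> 'a set" where
  "qadd V X Y = (\<Union>x\<in>X. \<Union>y\<in>Y. coset V (x + y))"

definition qmap :: "'a::ab_group_add set \<Rightarrow> ('a \<Rightarrow> 'a) \<Rightarrow> 'a set \<Rightarrow> 'a set" where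
  "qmap V f X = (\<Union>x\<in>X. coset V (f x))"

text \<open>Linear forms on \<open>U / V\<close>, as functions that are zero outside the quotient.\<close>

definition quot_dual :: "('m \<Rightarrow>\<^sub>0 'k::field) set \<Rightarrow> ('m \<Rightarrow>\<^sub>0 'k) set \<Rightarrow> (('m \<Rightarrow>\<^sub>0 'k) set \<Rightarrow> 'k) set" where
  "quot_dual U V = {l.
     (\<forall>X. X \<notin> quot U V \<longrightarrow> l X = 0) \<and>
     (\<forall>X\<in>quot U V. \<forall>Y\<in>quot U V. l (qadd V X Y) = l X + l Y) \<and>
     (\<forall>c. \<forall>X\<in>quot U V. l (qmap V (kscale c) X) = c * l X)}"

section \<open>Presentations and the module \<open>T\<^sup>1\<close>\<close>

text \<open>The polynomial ring on variables \<open>z\<^sub>w\<close>, \<open>w \<in> W\<close>, inside the polynomial ring with one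
  variable for each element of \<open>M\<close>.\<close>

type_synonym ('m, 'k) mpol = "('m \<Rightarrow>\<^sub>0 nat) \<Rightarrow>\<^sub>0 'k"

definition pol_ring :: "'m set \<Rightarrow> ('m, 'k::field) mpol set" where
  "pol_ring W = {f. \<forall>a\<in>Poly_Mapping.keys f. Poly_Mapping.keys a \<subseteq> W}"

definition mdeg :: "('m::ab_group_add \<Rightarrow>\<^sub>0 nat) \<Rightarrow> 'm" where
  "mdeg a = proj (Poly_Mapping.map int a)"

text \<open>The presentation map \<open>z\<^sub>w \<mapsto> \<chi>\<^sup>w\<close>, extended multiplicatively and \<open>k\<close>-linearly.\<close>

definition pres :: "('m::ab_group_add, 'k::field) mpol \<Rightarrow> ('m \<Rightarrow>\<^sub>0 'k)" where
  "pres f = (\<Sum>a\<in>Poly_Mapping.keys f. Poly_Mapping.single (mdeg a) (Poly_Mapping.lookup f a))"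

definition pres_ideal :: "'m::ab_group_add set \<Rightarrow> ('m, 'k::field) mpol set" where
  "pres_ideal W = {f \<in> pol_ring W. pres f = 0}"

definition pres_ideal_sq :: "'m::ab_group_add set \<Rightarrow> ('m, 'k::field) mpol set" where
  "pres_ideal_sq W = group_closure {f * g |f g. f \<in> pres_ideal W \<and> g \<in> pres_ideal W}"

abbreviation conormal :: "'m::ab_group_add set \<Rightarrow> ('m, 'k::field) mpol set set" where
  "conormal W \<equiv> quot (pres_ideal W) (pres_ideal_sq W)"

text \<open>In the following definition \<open>A = k[S]\<close> acts on \<open>I / I\<^sup>2\<close> through \<open>A = R / I\<close>: the element
  \<open>pres r\<close> acts as multiplication by \<open>r\<close>. Homomorphisms are zero outside \<open>I / I\<^sup>2\<close>, so that
  the module operations on them are pointwise.\<close>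

definition conormal_hom ::
  "'m::ab_group_add set \<Rightarrow> 'm set \<Rightarrow> (('m, 'k::field) mpol set \<Rightarrow> ('m \<Rightarrow>\<^sub>0 'k)) set" where
  "conormal_hom S W = {h.
     (\<forall>X. X \<notin> conormal W \<longrightarrow> h X = 0) \<and>
     (\<forall>X\<in>conormal W. h X \<in> monoid_alg S) \<and>
     (\<forall>X\<in>conormal W. \<forall>Y\<in>conormal W. h (qadd (pres_ideal_sq W) X Y) = h X + h Y) \<and>
     (\<forall>r\<in>pol_ring W. \<forall>X\<in>conormal W. h (qmap (pres_ideal_sq W) ((*) r) X) = pres r * h X)}"

definition pderiv_var :: "'m \<Rightarrow> ('m, 'k::field) mpol \<Rightarrow> ('m, 'k) mpol" where
  "pderiv_var w f = (\<Sum>a\<in>Poly_Mapping.keys f.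
     Poly_Mapping.single (a - Poly_Mapping.single w 1)
       (of_nat (Poly_Mapping.lookup a w) * Poly_Mapping.lookup f a))"

text \<open>The homomorphism \<open>I / I\<^sup>2 \<rightarrow> A\<close> induced by \<open>f \<mapsto> \<partial>f / \<partial>z\<^sub>w\<close>.\<close>

definition partial_hom ::
  "'m::ab_group_add set \<Rightarrow> 'm \<Rightarrow> ('m, 'k::field) mpol set \<Rightarrow> ('m \<Rightarrow>\<^sub>0 'k)" where
  "partial_hom W w = (\<lambda>X. if X \<in> conormal W
     then the_elem ((\<lambda>f. pres (pderiv_var w f)) ` X) else 0)"

definition alg_smult :: "('m::ab_group_add \<Rightarrow>\<^sub>0 'k::field) \<Rightarrow> ('a \<Rightarrow> ('m \<Rightarrow>\<^sub>0 'k)) \<Rightarrow> 'a \<Rightarrow> ('m \<Rightarrow>\<^sub>0 'k)" where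
  "alg_smult a h = (\<lambda>X. a * h X)"

definition alg_submodule :: "'m::ab_group_add set \<Rightarrow> ('a \<Rightarrow> ('m \<Rightarrow>\<^sub>0 'k::field)) set \<Rightarrow> bool" where
  "alg_submodule S N \<longleftrightarrow> 0 \<in> N \<and> (\<forall>h\<in>N. \<forall>g\<in>N. h + g \<in> N) \<and>
     (\<forall>a\<in>monoid_alg S. \<forall>h\<in>N. alg_smult a h \<in> N)"

definition der_submodule ::
  "'m::ab_group_add set \<Rightarrow> 'm set \<Rightarrow> (('m, 'k::field) mpol set \<Rightarrow> ('m \<Rightarrow>\<^sub>0 'k)) set" where
  "der_submodule S W = alg_submodule S hull (partial_hom W ` W)"

definition T1 ::
  "'m::ab_group_add set \<Rightarrow> 'm set \<Rightarrow> (('m, 'k::field) mpol set \<Rightarrow> ('m \<Rightarrow>\<^sub>0 'k)) set set" where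
  "T1 S W = quot (conormal_hom S W) (der_submodule S W)"

abbreviation T1_add ::
  "'m::ab_group_add set \<Rightarrow> 'm set \<Rightarrow> (('m, 'k::field) mpol set \<Rightarrow> ('m \<Rightarrow>\<^sub>0 'k)) set \<Rightarrow>
    (('m, 'k) mpol set \<Rightarrow> ('m \<Rightarrow>\<^sub>0 'k)) set \<Rightarrow> (('m, 'k) mpol set \<Rightarrow> ('m \<Rightarrow>\<^sub>0 'k)) set" where
  "T1_add S W \<equiv> qadd (der_submodule S W)"

abbreviation T1_smult ::
  "'m::ab_group_add set \<Rightarrow> 'm set \<Rightarrow> ('m \<Rightarrow>\<^sub>0 'k::field) \<Rightarrow>
    (('m, 'k) mpol set \<Rightarrow> ('m \<Rightarrow>\<^sub>0 'k)) set \<Rightarrow> (('m, 'k) mpol set \<Rightarrow> ('m \<Rightarrow>\<^sub>0 'k)) set" where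
  "T1_smult S W a \<equiv> qmap (der_submodule S W) (alg_smult a)"

abbreviation T1_zero ::
  "'m::ab_group_add set \<Rightarrow> 'm set \<Rightarrow> (('m, 'k::field) mpol set \<Rightarrow> ('m \<Rightarrow>\<^sub>0 'k)) set" where
  "T1_zero S W \<equiv> coset (der_submodule S W) 0"

text \<open>Gradings: a class in \<open>I / I\<^sup>2\<close> has degree \<open>d\<close> if it is represented by a homogeneous
  \<open>f \<in> I\<close> of degree \<open>d\<close>, and a class in \<open>T\<^sup>1\<close> has degree \<open>u\<close> if it is represented by a
  homomorphism of degree \<open>u\<close>.\<close>

definition hom_degree ::
  "'m::ab_group_add set \<Rightarrow> 'm \<Rightarrow> (('m, 'k::field) mpol set \<Rightarrow> ('m \<Rightarrow>\<^sub>0 'k)) \<Rightarrow> bool" where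
  "hom_degree W u h \<longleftrightarrow> (\<forall>d. \<forall>f\<in>pres_ideal W. (\<forall>a\<in>Poly_Mapping.keys f. mdeg a = d) \<longrightarrow>
     Poly_Mapping.keys (h (coset (pres_ideal_sq W) f)) \<subseteq> {d + u})"

definition T1_deg ::
  "'m::ab_group_add set \<Rightarrow> 'm set \<Rightarrow> 'm \<Rightarrow> (('m, 'k::field) mpol set \<Rightarrow> ('m \<Rightarrow>\<^sub>0 'k)) set set" where
  "T1_deg S W u = coset (der_submodule S W) ` {h \<in> conormal_hom S W. hom_degree W u h}"

section \<open>Linear relations\<close>

definition excl :: "'m::ab_group_add set \<Rightarrow> 'm set \<Rightarrow> 'm \<Rightarrow> 'm set" where
  "excl S F u = {w \<in> F. u + w \<notin> S}"

definition int_rel :: "'m::ab_group_add set \<Rightarrow> ('m \<Rightarrow>\<^sub>0 int) set" where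
  "int_rel F = {q. Poly_Mapping.keys q \<subseteq> F \<and> proj q = 0}"

text \<open>\<open>M \<otimes> k\<close> is the \<open>k\<close>-vector space with basis \<open>M\<close> (the type \<open>'m \<Rightarrow>\<^sub>0 'k\<close>; the basis element
  \<open>single x 1\<close> stands for \<open>x \<otimes> 1\<close>) modulo the subspace that makes \<open>x \<mapsto> x \<otimes> 1\<close> additive.
  With \<open>k\<^sup>F\<close> as above, \<open>\<pi> \<otimes> k\<close>, \<open>e\<^sub>w \<mapsto> w \<otimes> 1\<close>, sends \<open>c \<in> k\<^sup>F\<close> to the class of \<open>c\<close> itself, so
  its kernel consists of the \<open>c \<in> k\<^sup>F\<close> that lie in this subspace.\<close>

definition tensor_rel :: "('m::ab_group_add \<Rightarrow>\<^sub>0 'k::field) set" where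
  "tensor_rel = kvs.span {Poly_Mapping.single (x + y) 1 - Poly_Mapping.single x 1
                          - Poly_Mapping.single y 1 |x y. True}"

definition k_rel :: "'m::ab_group_add set \<Rightarrow> ('m \<Rightarrow>\<^sub>0 'k::field) set" where
  "k_rel F = {c. Poly_Mapping.keys c \<subseteq> F \<and> c \<in> tensor_rel}"

text \<open>\<open>rel_bar q = \<pi>(q\<^sup>+)\<close>, the common value of the two sides of the relation \<open>q\<close>.\<close>

definition rel_bar :: "('m::ab_group_add \<Rightarrow>\<^sub>0 int) \<Rightarrow> 'm" where
  "rel_bar q = proj (Poly_Mapping.map (max 0) q)"

definition k_span_int :: "('m::ab_group_add \<Rightarrow>\<^sub>0 int) set \<Rightarrow> ('m \<Rightarrow>\<^sub>0 'k::field) set" where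
  "k_span_int G = kvs.span (Poly_Mapping.map of_int ` G)"

definition rel_space :: "'m::ab_group_add set \<Rightarrow> 'm set \<Rightarrow> 'm \<Rightarrow> ('m \<Rightarrow>\<^sub>0 'k::field) set" where
  "rel_space S E u = k_rel (excl S E u)"

definition rel_sub :: "'m::ab_group_add set \<Rightarrow> 'm set \<Rightarrow> 'm \<Rightarrow> ('m \<Rightarrow>\<^sub>0 'k::field) set" where
  "rel_sub S E u = k_span_int {q \<in> int_rel (excl S E u). rel_bar q + u \<notin> S}"

definition rel_dual :: "'m::ab_group_add set \<Rightarrow> 'm set \<Rightarrow> 'm \<Rightarrow> (('m \<Rightarrow>\<^sub>0 'k::field) set \<Rightarrow> 'k) set" where
  "rel_dual S E u = quot_dual (rel_space S E u) (rel_sub S E u)"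

text \<open>The natural map between the dual spaces: a form on \<open>rel_space S E u\<close> that vanishes on
  \<open>rel_sub S E u\<close> is restricted to \<open>rel_space S E (u + w)\<close> and regarded as a form on the quotient
  by \<open>rel_sub S E (u + w)\<close>.\<close>

definition rel_dual_restrict ::
  "'m::ab_group_add set \<Rightarrow> 'm set \<Rightarrow> 'm \<Rightarrow> 'm \<Rightarrow>
    (('m \<Rightarrow>\<^sub>0 'k::field) set \<Rightarrow> 'k) \<Rightarrow> (('m \<Rightarrow>\<^sub>0 'k) set \<Rightarrow> 'k)" where
  "rel_dual_restrict S E u w l = (\<lambda>X.
     if X \<in> quot (rel_space S E (u + w)) (rel_sub S E (u + w))
     then the_elem ((\<lambda>q. l (coset (rel_sub S E u) q)) ` X) else 0)"

end

theory Submission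
  imports Defs
begin

text \<open>
  Write \<open>k[M]\<close> for the group algebra. A homomorphism \<open>h : I/I\<^sup>2 \<rightarrow> k[S]\<close> of degree \<open>u\<close> sends a binomial
  \<open>z\<^sup>a - z\<^sup>b\<close> of degree \<open>d\<close> to \<open>c(a,b) \<chi>\<^sup>d\<^sup>+\<^sup>u\<close>, and linearity makes \<open>c(a,b)\<close> an additive function of
  \<open>a - b \<in> L(W)\<close>. Since \<open>M\<close> is free, this function extends to coefficients \<open>\<phi> : W \<rightarrow> k\<close>, so \<open>h\<close> is the
  restriction to \<open>I\<close> of the derivation \<open>\<Sum>\<^sub>w \<phi>(w) \<chi>\<^sup>u\<^sup>+\<^sup>w \<partial>/\<partial>z\<^sub>w\<close> with values in \<open>k[M]\<close>
  (\<open>conormal_hom_eq_der\<close>). Conversely, the restriction of such a derivation takes values in \<open>k[S]\<close>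
  exactly when \<open>\<phi>\<close> vanishes on every relation \<open>q\<close> with \<open>\<pi>(q\<^sup>+) + u \<notin> S\<close>. Such a relation is
  automatically supported on \<open>W\<^sup>u = {w. u + w \<notin> S}\<close> (\<open>diff_in_vanishing_rels\<close>).

  The derivation has class zero in \<open>T\<^sup>1\<close> exactly when \<open>\<phi>\<close> can be changed to be zero on \<open>W\<^sup>u\<close> without
  changing its values on \<open>L\<^sub>k(W)\<close>, because \<open>\<chi>\<^sup>u\<^sup>+\<^sup>w\<close> is an element of \<open>k[S]\<close> precisely for the
  remaining \<open>w\<close>. By linear algebra this means that \<open>\<phi>\<close> vanishes on \<open>L\<^sub>k(W\<^sup>u)\<close> (\<open>der_class_eq_iff\<close>). Here
  \<open>L\<^sub>k(W)\<close> is the span of \<open>L(W)\<close>, again because \<open>M\<close> is free (\<open>k_rel_subset_span\<close>). Restricting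
  \<open>\<phi>\<close> to \<open>L\<^sub>k(W\<^sup>u)\<close> thus identifies the degree \<open>u\<close> part of \<open>T\<^sup>1\<close> with the linear forms on
  \<open>L\<^sub>k(W\<^sup>u)\<close> that vanish on the relations above.

  It remains to pass from the generators \<open>W\<close> of the presentation to the generators \<open>E\<close>.
  Expressing each \<open>e \<in> E\<close> as a sum of elements of \<open>W\<close> gives a map from \<open>L\<^sub>k(E\<^sup>u)\<close> to \<open>L\<^sub>k(W\<^sup>u)\<close>, and
  going back and forth changes a relation only by vanishing relations (\<open>subst_subst\<close>). The form
  that belongs to \<open>\<phi>\<close> is therefore \<open>c \<mapsto> \<phi>(\<alpha> c)\<close>, where \<open>\<alpha>\<close> is this map. Neither \<open>\<alpha>\<close> nor \<open>\<phi>\<close>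
  depends on \<open>u\<close>: multiplication of the derivation with \<open>\<chi>\<^sup>w\<close> replaces \<open>u\<close> by \<open>u + w\<close> and
  keeps \<open>\<phi>\<close>, so on the side of the forms it is the restriction.
\<close>

abbreviation (input) "lookup \<equiv> Poly_Mapping.lookup"
abbreviation (input) "keys \<equiv> Poly_Mapping.keys"
abbreviation (input) "single \<equiv> Poly_Mapping.single"

section \<open>Sums over the keys of a finitely supported function\<close>

lemma lookup_map_zero:
  "f 0 = 0 \<Longrightarrow> lookup (Poly_Mapping.map f p) x = f (lookup p x)"
  by (simp add: Poly_Mapping.map.rep_eq when_def)

lemma keys_add_subset: "keys c \<subseteq> A \<Longrightarrow> keys d \<subseteq> A \<Longrightarrow> keys (c + d) \<subseteq> A"
  using keys_add[of c d] by blast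

lemma keys_diff_subset:
  fixes c d :: "'a \<Rightarrow>\<^sub>0 'b::ab_group_add"
  shows "keys c \<subseteq> A \<Longrightarrow> keys d \<subseteq> A \<Longrightarrow> keys (c - d) \<subseteq> A"
  using keys_diff[of c d] by blast

lemma sum_keys_superset:
  fixes G :: "'a \<Rightarrow> 'b::zero \<Rightarrow> 'c::comm_monoid_add"
  assumes "finite A" "keys c \<subseteq> A" "\<And>x. G x 0 = 0"
  shows "(\<Sum>x\<in>keys c. G x (lookup c x)) = (\<Sum>x\<in>A. G x (lookup c x))"
  using assms by (intro sum.mono_neutral_left) (auto simp: in_keys_iff)

lemma sum_keys_add:
  fixes G :: "'a \<Rightarrow> 'b::comm_monoid_add \<Rightarrow> 'c::ab_group_add"
  assumes "\<And>x m n. G x (m + n) = G x m + G x n"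
  shows "(\<Sum>x\<in>keys (c + d). G x (lookup (c + d) x)) =
    (\<Sum>x\<in>keys c. G x (lookup c x)) + (\<Sum>x\<in>keys d. G x (lookup d x))"
proof -
  have G0: "G x 0 = 0" for x
    using assms[of x 0 0] by simp
  have A: "finite (keys c \<union> keys d)" "keys (c + d) \<subseteq> keys c \<union> keys d"
    by (auto simp: keys_add)
  show ?thesis
    using G0 A assms
    by (subst (1 2 3) sum_keys_superset[where A = "keys c \<union> keys d"])
      (auto simp: lookup_add sum.distrib)
qed

lemma poly_mapping_add_induct [case_names zero single add]:
  fixes c :: "'a \<Rightarrow>\<^sub>0 'b::comm_monoid_add"
  assumes "P 0" "\<And>x m. P (single x m)" "\<And>c d. P c \<Longrightarrow> P d \<Longrightarrow> P (c + d)"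
  shows "P c"
proof -
  have "P (\<Sum>x\<in>A. single x (lookup c x))" if "finite A" for A
    using that by induction (auto intro: assms)
  moreover have "c = (\<Sum>x\<in>keys c. single x (lookup c x))"
    by (intro poly_mapping_eqI) (auto simp: lookup_sum lookup_single when_def in_keys_iff)
  ultimately show ?thesis
    by (metis finite_keys)
qed

section \<open>Degrees of exponent vectors\<close>

lemma zmult_0 [simp]: "zmult 0 x = 0"
  by (simp add: zmult_def)

lemma zmult_add_one: "zmult (n + 1) x = zmult n x + x"
proof (cases "n \<ge> 0")
  case True
  then show ?thesis by (simp add: zmult_def nat_add_distrib)
next
  case False
  then obtain m where "n = - int (Suc m)"
    by (metis nat_0_le not_le_imp_less minus_minus neg_less_0_iff_less gr0_conv_Suc zero_less_nat_eq less_le)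
  then show ?thesis by (cases m) (auto simp: zmult_def nat_add_distrib)
qed

lemma zmult_add_left: "zmult (m + n) x = zmult m x + zmult n x"
proof (induction n rule: int_induct[where k = 0])
  case (step1 i)
  then show ?case using zmult_add_one[of "m + i" x] zmult_add_one[of i x] by (simp add: algebra_simps)
next
  case (step2 i)
  then show ?case using zmult_add_one[of "m + (i - 1)" x] zmult_add_one[of "i - 1" x]
    by (simp add: algebra_simps)
qed simp

lemma zmult_1 [simp]: "zmult 1 x = x"
  using zmult_add_one[of 0 x] by simp

text \<open>An additive map is automatically \<open>\<int>\<close>-linear.\<close>

lemma additive_zmult:
  assumes "\<And>x y. f (x + y) = f x + f y"
  shows "f (zmult n x) = zmult n (f x)"
proof -
  have f0: "f 0 = 0" using assms[of 0 0] by simp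
  show ?thesis
  proof (induction n rule: int_induct[where k = 0])
    case (step1 i)
    then show ?case by (simp add: zmult_add_one assms)
  next
    case (step2 i)
    then show ?case
      using zmult_add_one[of "i - 1" x] zmult_add_one[of "i - 1" "f x"] assms[of "zmult (i - 1) x" x]
      by simp
  qed (simp add: f0)
qed

lemma proj_add: "proj (c + d) = proj c + proj d"
  unfolding proj_def by (rule sum_keys_add) (rule zmult_add_left)

lemma proj_zero [simp]: "proj 0 = 0"
  by (simp add: proj_def)

lemma proj_minus: "proj (- c) = - proj c"
  using proj_add[of c "- c"] by (simp add: add_eq_0_iff)

lemma proj_diff: "proj (c - d) = proj c - proj d"
  using proj_add[of c "- d"] by (simp add: proj_minus)

lemma proj_single: "proj (single w n) = zmult n w"
  by (cases "n = 0") (auto simp: proj_def)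

abbreviation zvec :: "('m \<Rightarrow>\<^sub>0 nat) \<Rightarrow> 'm \<Rightarrow>\<^sub>0 int" where
  "zvec \<equiv> Poly_Mapping.map int"

abbreviation kvec :: "('m \<Rightarrow>\<^sub>0 int) \<Rightarrow> 'm \<Rightarrow>\<^sub>0 'k::field" where
  "kvec \<equiv> Poly_Mapping.map of_int"

lemma keys_zvec [simp]: "keys (zvec a) = keys a"
  by (auto simp: in_keys_iff lookup_map_zero)

lemma zvec_add: "zvec (a + b) = zvec a + zvec b"
  by (intro poly_mapping_eqI) (simp add: lookup_map_zero lookup_add)

lemma kvec_add: "kvec (c + d) = kvec c + kvec d"
  by (intro poly_mapping_eqI) (simp add: lookup_map_zero lookup_add)

lemma kvec_diff: "kvec (c - d) = kvec c - kvec d"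
  by (intro poly_mapping_eqI) (simp add: lookup_map_zero lookup_minus)

lemma keys_kvec: "keys (kvec c) \<subseteq> keys c"
  by (auto simp: in_keys_iff lookup_map_zero)

lemma mdeg_add: "mdeg (a + b) = mdeg a + mdeg b"
  by (simp add: mdeg_def zvec_add proj_add)

lemma mdeg_zero [simp]: "mdeg 0 = 0"
  using mdeg_add[of 0 0] by simp

lemma mdeg_single: "mdeg (single w n) = zmult (int n) w"
  by (simp add: mdeg_def proj_single)

lemma mdeg_single_one [simp]: "mdeg (single w (Suc 0)) = w"
  by (simp add: mdeg_single)

text \<open>The vectors \<open>q\<^sup>+\<close> and \<open>q\<^sup>-\<close> are the truncations of \<open>q\<close> and \<open>-q\<close> to the natural numbers.\<close>

definition pos_part :: "('m \<Rightarrow>\<^sub>0 int) \<Rightarrow> 'm \<Rightarrow>\<^sub>0 nat" where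
  "pos_part q = Poly_Mapping.map nat q"

lemma lookup_pos_part: "lookup (pos_part q) x = nat (lookup q x)"
  by (simp add: pos_part_def lookup_map_zero)

lemma keys_pos_part: "keys (pos_part q) \<subseteq> keys q" "keys (pos_part (- q)) \<subseteq> keys q"
  by (auto simp: in_keys_iff lookup_pos_part)

lemma pos_part_diff: "zvec (pos_part q) - zvec (pos_part (- q)) = q"
  by (intro poly_mapping_eqI) (simp add: lookup_minus lookup_map_zero lookup_pos_part)

lemma rel_bar_eq: "rel_bar q = mdeg (pos_part q)"
proof -
  have "Poly_Mapping.map (max 0) q = zvec (pos_part q)"
    by (intro poly_mapping_eqI) (simp add: lookup_map_zero lookup_pos_part)
  then show ?thesis by (simp add: rel_bar_def mdeg_def)
qed

lemma mdeg_pos_part_minus: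
  assumes "proj q = 0"
  shows "mdeg (pos_part (- q)) = mdeg (pos_part q)"
  using assms proj_diff[of "zvec (pos_part q)" "zvec (pos_part (- q))"]
  by (simp add: pos_part_diff mdeg_def)

lemma add_submonoid_hull:
  fixes S E :: "'m::ab_group_add set"
  assumes "add_submonoid hull E = S"
  shows "S = {mdeg a |a. keys a \<subseteq> E}"
proof
  have "add_submonoid {mdeg a |a. keys a \<subseteq> E}"
    unfolding add_submonoid_def
  proof (intro conjI ballI)
    show "0 \<in> {mdeg a |a. keys a \<subseteq> E}" 
      by (auto intro!: exI[of _ 0])
    fix x y assume "x \<in> {mdeg a |a. keys a \<subseteq> E}" "y \<in> {mdeg a |a. keys a \<subseteq> E}"
    then obtain a b where "x = mdeg a" "keys a \<subseteq> E" "y = mdeg b" "keys b \<subseteq> E" by auto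
    then show "x + y \<in> {mdeg a |a. keys a \<subseteq> E}"
      using keys_add[of a b] by (auto intro!: exI[of _ "a + b"] simp: mdeg_add)
  qed
  moreover have "E \<subseteq> {mdeg a |a. keys a \<subseteq> E}"
  proof
    fix e assume "e \<in> E"
    then show "e \<in> {mdeg a |a. keys a \<subseteq> E}"
      by (auto intro!: exI[of _ "single e (Suc 0)"])
  qed
  ultimately show "S \<subseteq> {mdeg a |a. keys a \<subseteq> E}"
    unfolding assms[symmetric] by (intro hull_minimal)
next
  have S: "add_submonoid S"
    unfolding assms[symmetric] by (rule hull_in) (auto simp: add_submonoid_def)
  have "E \<subseteq> S" using assms hull_subset[of E add_submonoid] by simp
  have "keys a \<subseteq> E \<Longrightarrow> mdeg a \<in> S" for a
  proof -
    assume "keys a \<subseteq> E"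
    have *: "zmult (int n) w \<in> S" if "w \<in> S" for n w
    proof (induction n)
      case (Suc n)
      moreover have "zmult (int (Suc n)) w = zmult (int n) w + w"
        using zmult_add_one[of "int n" w] by (simp add: add.commute)
      ultimately show ?case using S that by (simp add: add_submonoid_def)
    qed (use S in \<open>simp add: add_submonoid_def\<close>)
    have "(\<Sum>w\<in>A. zmult (int (lookup a w)) w) \<in> S" if "finite A" "A \<subseteq> E" for A
      using that
      by induction (use S \<open>E \<subseteq> S\<close> in \<open>auto simp: add_submonoid_def intro!: *\<close>)
    from this[of "keys a"] \<open>keys a \<subseteq> E\<close> show "mdeg a \<in> S"
      by (simp add: mdeg_def proj_def lookup_map_zero)
  qed
  then show "{mdeg a |a. keys a \<subseteq> E} \<subseteq> S" by auto
qed

section \<open>Linear maps out of \<open>k\<^sup>M\<close>\<close>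

interpretation kvp: vector_space_pair
  "kscale :: 'k::field \<Rightarrow> ('m \<Rightarrow>\<^sub>0 'k) \<Rightarrow> ('m \<Rightarrow>\<^sub>0 'k)" "(*) :: 'k \<Rightarrow> 'k \<Rightarrow> 'k"
  by unfold_locales (auto simp: algebra_simps)

(* for the field acting on itself this is the reversed associative law, which makes the
   simplifier loop together with the usual one *)
declare kvp.vs2.scale_scale [simp del]

lemma kscale_single [simp]: "kscale m (single x n) = single x (m * n)"
  by (intro poly_mapping_eqI) (simp add: lookup_single when_def)

lemma keys_kscale: "keys (kscale m f) \<subseteq> keys f"
  by (auto simp: in_keys_iff)

definition pair :: "('m \<Rightarrow> 'k::field) \<Rightarrow> ('m \<Rightarrow>\<^sub>0 'k) \<Rightarrow> 'k" where
  "pair \<phi> c = (\<Sum>x\<in>keys c. \<phi> x * lookup c x)"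

lemma pair_add: "pair \<phi> (c + d) = pair \<phi> c + pair \<phi> d"
  unfolding pair_def by (rule sum_keys_add) (simp add: algebra_simps)

lemma pair_zero [simp]: "pair \<phi> 0 = 0"
  by (simp add: pair_def)

lemma pair_superset: "finite A \<Longrightarrow> keys c \<subseteq> A \<Longrightarrow> pair \<phi> c = (\<Sum>x\<in>A. \<phi> x * lookup c x)"
  unfolding pair_def by (rule sum_keys_superset) auto

lemma pair_kscale: "pair \<phi> (kscale m c) = m * pair \<phi> c"
  by (subst pair_superset[OF finite_keys keys_kscale])
    (simp only: pair_def sum_distrib_left lookup_kscale mult.left_commute)

lemma pair_minus: "pair \<phi> (- c) = - pair \<phi> c"
  using pair_add[of \<phi> c "- c"] by (simp add: add_eq_0_iff)

lemma pair_diff: "pair \<phi> (c - d) = pair \<phi> c - pair \<phi> d"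
  using pair_add[of \<phi> c "- d"] by (simp add: pair_minus)

lemma pair_single [simp]: "pair \<phi> (single x m) = \<phi> x * m"
  by (cases "m = 0") (auto simp: pair_def)

lemma pair_indicator: "pair (\<lambda>x. if x = w then 1 else 0) c = lookup c w"
  by (induction c rule: poly_mapping_add_induct)
    (auto simp: pair_add lookup_add lookup_single when_def)

lemma pair_cong: "(\<And>x. x \<in> keys c \<Longrightarrow> \<phi> x = \<psi> x) \<Longrightarrow> pair \<phi> c = pair \<psi> c"
  by (simp add: pair_def)

lemma pair_left_add: "pair (\<lambda>x. \<phi> x + \<psi> x) c = pair \<phi> c + pair \<psi> c"
  by (simp add: pair_def sum.distrib algebra_simps)

lemma pair_left_diff: "pair (\<lambda>x. \<phi> x - \<psi> x) c = pair \<phi> c - pair \<psi> c"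
  by (simp add: pair_def sum_subtractf algebra_simps)

lemma pair_left_mult: "pair (\<lambda>x. m * \<phi> x) c = m * pair \<phi> c"
  by (simp only: pair_def sum_distrib_left mult.assoc)

lemma pair_span_eq_0:
  assumes "\<And>x. x \<in> A \<Longrightarrow> pair \<phi> x = 0" "c \<in> kvs.span A"
  shows "pair \<phi> c = 0"
  using assms(2)
  by (rule kvs.span_induct)
    (auto simp: kvs.subspace_def pair_add pair_kscale assms(1))

lemma linear_eq_pair:
  assumes "Vector_Spaces.linear kscale (*) g"
  shows "g c = pair (\<lambda>x. g (single x 1)) c"
proof (induction c rule: poly_mapping_add_induct)
  case zero
  then show ?case using kvp.linear_0[OF assms] by simp
next
  case (single x m)
  have "g (kscale m (single x 1)) = m * g (single x 1)"
    using kvp.linear_scale[OF assms] .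
  then show ?case by (simp add: mult.commute)
next
  case (add c d)
  then show ?case by (simp add: kvp.linear_add[OF assms] pair_add)
qed

text \<open>A linear form on a subspace \<open>K\<close> that vanishes on \<open>K \<inter> T\<close> is well defined on \<open>K + T\<close>,
  with value zero on \<open>T\<close>. A basis of \<open>T\<close>, completed by vectors of \<open>K\<close> to one of \<open>K + T\<close>, gives
  an extension to the whole space.\<close>

lemma linear_form_extend:
  fixes K T :: "('m \<Rightarrow>\<^sub>0 'k::field) set" and f :: "('m \<Rightarrow>\<^sub>0 'k) \<Rightarrow> 'k"
  assumes K: "kvs.subspace K" and T: "kvs.subspace T"
    and add: "\<And>x y. x \<in> K \<Longrightarrow> y \<in> K \<Longrightarrow> f (x + y) = f x + f y"
    and scale: "\<And>m x. x \<in> K \<Longrightarrow> f (kscale m x) = m * f x"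
    and zero: "\<And>x. x \<in> K \<Longrightarrow> x \<in> T \<Longrightarrow> f x = 0"
  obtains \<psi> where "\<And>x. x \<in> K \<Longrightarrow> pair \<psi> x = f x" "\<And>x. x \<in> T \<Longrightarrow> pair \<psi> x = 0"
proof -
  obtain B0 where B0: "B0 \<subseteq> T" "kvs.independent B0" "T \<subseteq> kvs.span B0"
    using kvs.maximal_independent_subset .
  obtain B where B: "B0 \<subseteq> B" "B \<subseteq> B0 \<union> K" "kvs.independent B" "B0 \<union> K \<subseteq> kvs.span B"
    using kvs.maximal_independent_subset_extend[of B0 "B0 \<union> K"] B0 by auto
  obtain g where g: "Vector_Spaces.linear kscale (*) g"
    and gB: "\<And>x. x \<in> B \<Longrightarrow> g x = (if x \<in> B0 then 0 else f x)"
    using kvp.linear_independent_extend[OF B(3), of "\<lambda>x. if x \<in> B0 then 0 else f x"] by auto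
  have gT: "g x = 0" if "x \<in> T" for x
    by (rule kvp.linear_eq_0_on_span[OF g, of B0]) (use that B0 B(1) gB in auto)
  have f0: "f 0 = 0"
    using scale[of 0 0] kvs.subspace_0[OF K] by simp
  have gK: "g x = f x" if x: "x \<in> K" for x
  proof -
    have "x \<in> kvs.span (B0 \<union> (B - B0))"
      using x B by (metis Un_Diff_cancel Un_absorb1 Un_iff subsetD)
    then obtain t y where ty: "x = t + y" "t \<in> kvs.span B0" "y \<in> kvs.span (B - B0)"
      unfolding kvs.span_Un by auto
    have tT: "t \<in> T"
      using ty(2) B0(1) T kvs.span_minimal by blast
    have "y \<in> {y \<in> K. g y = f y}"
    proof (rule kvs.span_induct[OF ty(3)])
      show "kvs.subspace {y. y \<in> {y \<in> K. g y = f y}}"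
        using K by (auto simp: kvs.subspace_def f0 add scale kvp.linear_0[OF g]
            kvp.linear_add[OF g] kvp.linear_scale[OF g])
    qed (use B gB in auto)
    then have y: "y \<in> K" "g y = f y" by auto
    have "t \<in> K"
      using ty(1) x y(1) kvs.subspace_diff[OF K, of x y] by simp
    then have "f x = f y"
      using add[of t y] zero[of t] tT y(1) ty(1) by simp
    moreover have "g x = g y"
      using ty(1) gT[OF tT] by (simp add: kvp.linear_add[OF g])
    ultimately show ?thesis using y(2) by simp
  qed
  show thesis
    by (rule that[of "\<lambda>x. g (single x 1)"])
      (simp_all add: linear_eq_pair[OF g, symmetric] gK gT)
qed

definition lext :: "('m \<Rightarrow> 'n \<Rightarrow>\<^sub>0 'k::field) \<Rightarrow> ('m \<Rightarrow>\<^sub>0 'k) \<Rightarrow> 'n \<Rightarrow>\<^sub>0 'k" where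
  "lext g c = (\<Sum>x\<in>keys c. kscale (lookup c x) (g x))"

lemma lext_add: "lext g (c + d) = lext g c + lext g d"
  unfolding lext_def by (rule sum_keys_add) (rule kvs.scale_left_distrib)

lemma lext_zero [simp]: "lext g 0 = 0"
  by (simp add: lext_def)

lemma lext_kscale: "lext g (kscale m c) = kscale m (lext g c)"
  unfolding lext_def
  by (subst sum_keys_superset[OF finite_keys keys_kscale]) (auto simp: kvs.scale_sum_right)

lemma lext_minus: "lext g (- c) = - lext g c"
  using lext_add[of g c "- c"] by (simp add: add_eq_0_iff)

lemma lext_diff: "lext g (c - d) = lext g c - lext g d"
  using lext_add[of g c "- d"] by (simp add: lext_minus)

lemma lext_single [simp]: "lext g (single x m) = kscale m (g x)"
  by (cases "m = 0") (auto simp: lext_def)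

lemma lext_singles [simp]: "lext (\<lambda>x. single x 1) c = c"
  by (induction c rule: poly_mapping_add_induct) (auto simp: lext_add)

lemma lext_left_diff: "lext (\<lambda>x. g x - h x) c = lext g c - lext h c"
  by (simp add: lext_def sum_subtractf kvs.scale_right_diff_distrib)

lemma lext_lext: "lext g (lext h c) = lext (\<lambda>x. lext g (h x)) c"
  by (induction c rule: poly_mapping_add_induct) (auto simp: lext_add lext_kscale)

lemma lext_in_subspace:
  assumes "kvs.subspace U" "\<And>x. x \<in> keys c \<Longrightarrow> g x \<in> U"
  shows "lext g c \<in> U"
  unfolding lext_def using assms by (intro kvs.subspace_sum kvs.subspace_scale)

lemma subspace_keys: "kvs.subspace {c. keys c \<subseteq> A}"
  by (auto simp: kvs.subspace_def dest: subsetD[OF keys_add] subsetD[OF keys_kscale])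

section \<open>Relations over the integers and over the field\<close>

lemma subspace_tensor_rel: "kvs.subspace tensor_rel"
  by (simp add: tensor_rel_def)

lemma tensor_rel_single_add:
  "single (x + y) 1 - single x 1 - single y 1 \<in> tensor_rel"
  unfolding tensor_rel_def by (rule kvs.span_base) blast

lemma one_in_tensor_rel: "1 \<in> tensor_rel"
  using tensor_rel_single_add[of 0 0] kvs.subspace_neg[OF subspace_tensor_rel] by fastforce

lemma tensor_rel_single_zmult:
  "(single (zmult n x) 1 - single x (of_int n) :: 'm::ab_group_add \<Rightarrow>\<^sub>0 'k::field) \<in> tensor_rel"
proof (induction n rule: int_induct[where k = 0])
  case base
  then show ?case by (simp add: one_in_tensor_rel)
next
  case (step1 i)
  then show ?case
    using kvs.subspace_add[OF subspace_tensor_rel step1(2) tensor_rel_single_add[of "zmult i x" x]]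
    unfolding zmult_add_one by (simp add: single_add diff_diff_eq add_ac)
next
  case (step2 i)
  have "zmult i x = zmult (i - 1) x + x"
    using zmult_add_one[of "i - 1" x] by simp
  then show ?case
    using kvs.subspace_diff[OF subspace_tensor_rel step2(2)
        tensor_rel_single_add[of "zmult (i - 1) x" x]]
    by (simp add: single_diff algebra_simps)
qed

text \<open>In \<open>M \<otimes> k\<close>, the class of an integral vector is \<open>\<pi>(c) \<otimes> 1\<close>.\<close>

lemma tensor_rel_single_proj: "single (proj c) 1 - kvec c \<in> tensor_rel"
proof (induction c rule: poly_mapping_add_induct)
  case zero
  then show ?case by (simp add: one_in_tensor_rel map_eq_zero_iff[THEN iffD2])
next
  case (single x m)
  then show ?case using tensor_rel_single_zmult[of m x] by (simp add: proj_single)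
next
  case (add c d)
  have "single (proj (c + d)) 1 - kvec (c + d) =
      (single (proj c + proj d) 1 - single (proj c) 1 - single (proj d) 1) +
      (single (proj c) 1 - kvec c) + (single (proj d) 1 - kvec d)"
    by (simp add: proj_add kvec_add)
  then show ?case
    using kvs.subspace_add[OF subspace_tensor_rel] add tensor_rel_single_add by metis
qed

lemma kvec_in_tensor_rel: "proj q = 0 \<Longrightarrow> kvec q \<in> tensor_rel"
  using tensor_rel_single_proj[of q] one_in_tensor_rel
    kvs.subspace_diff[OF subspace_tensor_rel] by fastforce

lemma lext_tensor_rel:
  assumes "\<And>x y. g (x + y) = g x + g y" "c \<in> tensor_rel"
  shows "lext g c = 0"
  using assms(2) unfolding tensor_rel_def
  by (rule kvs.span_induct)
    (auto simp: kvs.subspace_def lext_add lext_kscale lext_diff assms(1))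

text \<open>A lattice is free, so the surjection \<open>\<int>\<^sup>W \<rightarrow> M\<close> splits.\<close>

lemma lattice_splitting:
  fixes B W :: "'m::ab_group_add set"
  assumes B: "lattice_basis B" and W: "\<And>x. \<exists>c. keys c \<subseteq> W \<and> proj c = x"
  obtains s :: "'m \<Rightarrow> 'm \<Rightarrow>\<^sub>0 int"
  where "\<And>x y. s (x + y) = s x + s y" "\<And>x. keys (s x) \<subseteq> W" "\<And>x. proj (s x) = x"
proof -
  obtain r where r: "\<And>x. keys (r x) \<subseteq> W" "\<And>x. proj (r x) = x"
    using W by metis
  define coord where "coord x = (THE c. keys c \<subseteq> B \<and> proj c = x)" for x
  have ex1: "\<exists>!c. keys c \<subseteq> B \<and> proj c = x" for x
    using B by (auto simp: lattice_basis_def)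
  have coord: "keys (coord x) \<subseteq> B" "proj (coord x) = x" for x
    using theI'[OF ex1[of x]] by (auto simp: coord_def)
  have coord_add: "coord (x + y) = coord x + coord y" for x y
  proof -
    have "keys (coord x + coord y) \<subseteq> B \<and> proj (coord x + coord y) = x + y"
      using coord by (simp add: proj_add keys_add_subset)
    then show ?thesis using ex1[of "x + y"] coord by auto
  qed
  define lift where "lift c = (\<Sum>b\<in>keys c. Poly_Mapping.map ((*) (lookup c b)) (r b))" for c
  have lift_add: "lift (c + d) = lift c + lift d" for c d
    unfolding lift_def
    by (rule sum_keys_add)
      (auto intro!: poly_mapping_eqI simp: lookup_map_zero lookup_add algebra_simps)
  have proj_map: "proj (Poly_Mapping.map ((*) m) c) = zmult m (proj c)" for m and c :: "'m \<Rightarrow>\<^sub>0 int"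
  proof -
    have "Poly_Mapping.map ((*) m) c = zmult m c"
    proof (induction m rule: int_induct[where k = 0])
      case base
      then show ?case by (simp add: map_eq_zero_iff)
    next
      case (step1 i)
      then show ?case unfolding zmult_add_one step1(2)[symmetric]
        by (auto intro!: poly_mapping_eqI simp: lookup_map_zero lookup_add algebra_simps)
    next
      case (step2 i)
      have *: "zmult (i - 1) c = zmult i c - c"
        using zmult_add_one[of "i - 1" c] by simp
      show ?case unfolding * step2(2)[symmetric]
        by (intro poly_mapping_eqI) (simp add: lookup_map_zero lookup_minus left_diff_distrib)
    qed
    then show ?thesis by (simp add: additive_zmult[of proj] proj_add)
  qed
  have lift_single: "lift (single b m) = Poly_Mapping.map ((*) m) (r b)" for b m
    by (cases "m = 0") (auto simp: lift_def map_eq_zero_iff)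
  have proj_lift: "proj (lift c) = proj c" for c
  proof (induction c rule: poly_mapping_add_induct)
    case zero
    then show ?case by (simp add: lift_def)
  qed (simp_all add: lift_single proj_map proj_single r lift_add proj_add)
  have keys_lift: "keys (lift c) \<subseteq> W" for c
  proof -
    have "keys (Poly_Mapping.map ((*) m) (r b)) \<subseteq> W" for m b
      using r(1)[of b] by (auto simp: in_keys_iff lookup_map_zero)
    then show ?thesis unfolding lift_def
      by (intro order_trans[OF keys_sum]) auto
  qed
  show thesis
    by (rule that[of "\<lambda>x. lift (coord x)"])
      (simp_all only: coord_add lift_add proj_lift coord keys_lift)
qed

text \<open>Flatness of \<open>k\<close> in the present situation: \<open>L\<^sub>k(W)\<close> is the span of \<open>L(W)\<close>. With a
  splitting \<open>s\<close>, the vectors \<open>e\<^sub>w - s(w)\<close> are relations, and a linear combination of them with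
  coefficients \<open>c\<close> is \<open>c\<close> itself if \<open>c\<close> is a relation over \<open>k\<close>.\<close>

lemma k_rel_subset_span:
  fixes W :: "'m::ab_group_add set"
  assumes s: "\<And>x y. s (x + y) = s x + s y" "\<And>x. keys (s x) \<subseteq> W" "\<And>x. proj (s x) = x"
  shows "(k_rel W :: ('m \<Rightarrow>\<^sub>0 'k::field) set) \<subseteq> k_span_int (int_rel W)"
proof
  fix c :: "'m \<Rightarrow>\<^sub>0 'k" assume c: "c \<in> k_rel W"
  have "single w 1 - s w \<in> int_rel W" if "w \<in> W" for w
    using s that by (simp add: int_rel_def proj_diff proj_single keys_diff_subset)
  then have "lext (\<lambda>w. kvec (single w 1 - s w)) c \<in> k_span_int (int_rel W)"
    unfolding k_span_int_def using c
    by (intro lext_in_subspace kvs.subspace_span kvs.span_base) (auto simp: k_rel_def)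
  moreover have "lext (\<lambda>w. kvec (s w)) c = 0"
    using c by (intro lext_tensor_rel) (auto simp: k_rel_def s kvec_add)
  ultimately show "c \<in> k_span_int (int_rel W)"
    by (simp add: kvec_diff lext_left_diff)
qed

text \<open>The integral relations whose \<open>k\<close>-span is divided out on the side of the linear forms.\<close>

definition vanishing_rels :: "'m::ab_group_add set \<Rightarrow> 'm set \<Rightarrow> 'm \<Rightarrow> ('m \<Rightarrow>\<^sub>0 int) set" where
  "vanishing_rels S F u = {q \<in> int_rel (excl S F u). rel_bar q + u \<notin> S}"

lemma rel_sub_eq: "rel_sub S F u = k_span_int (vanishing_rels S F u)"
  by (simp add: rel_sub_def vanishing_rels_def)

lemma subspace_rel_sub: "kvs.subspace (rel_sub S F u)"
  by (simp add: rel_sub_eq k_span_int_def)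

lemma subspace_rel_space: "kvs.subspace (rel_space S F u :: ('m::ab_group_add \<Rightarrow>\<^sub>0 'k::field) set)"
proof -
  have "(rel_space S F u :: ('m \<Rightarrow>\<^sub>0 'k) set) = {c. keys c \<subseteq> excl S F u} \<inter> tensor_rel"
    by (auto simp: rel_space_def k_rel_def)
  then show ?thesis
    using kvs.subspace_inter[OF subspace_keys[of "excl S F u"] subspace_tensor_rel] by simp
qed

lemma rel_sub_subset_rel_space: "rel_sub S F u \<subseteq> rel_space S F u"
  unfolding rel_sub_eq k_span_int_def
proof (rule kvs.span_minimal[OF _ subspace_rel_space], safe)
  fix q assume "q \<in> vanishing_rels S F u"
  then show "kvec q \<in> rel_space S F u"
    using keys_kvec[of q]
    by (auto simp: vanishing_rels_def int_rel_def rel_space_def k_rel_def intro: kvec_in_tensor_rel)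
qed

definition generates :: "'m::ab_group_add set \<Rightarrow> 'm set \<Rightarrow> bool" where
  "generates F S \<longleftrightarrow> S = {mdeg a |a. keys a \<subseteq> F}"

lemma mdeg_in_monoid: "generates F S \<Longrightarrow> keys a \<subseteq> F \<Longrightarrow> mdeg a \<in> S"
  by (auto simp: generates_def)

lemma monoid_add:
  assumes "generates F S" "x \<in> S" "y \<in> S"
  shows "x + y \<in> S"
proof -
  obtain a b where "keys a \<subseteq> F" "x = mdeg a" "keys b \<subseteq> F" "y = mdeg b"
    using assms by (auto simp: generates_def)
  then show ?thesis
    using mdeg_in_monoid[OF assms(1), of "a + b"] keys_add[of a b] by (auto simp: mdeg_add)
qed

lemma sub_vector:
  assumes "\<And>x. lookup b x \<le> (lookup a x :: nat)"
  shows "a = b + (a - b)" "keys (a - b) \<subseteq> keys a"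
  using assms
  by (auto intro!: poly_mapping_eqI simp: lookup_add lookup_minus in_keys_iff)

lemma monoid_sub_key:
  assumes "generates F S" "keys a \<subseteq> F" "w \<in> keys a"
  obtains x where "x \<in> S" "mdeg a = x + w"
proof
  have *: "a = single w 1 + (a - single w 1)" "keys (a - single w 1) \<subseteq> keys a"
    by (rule sub_vector; use assms in \<open>auto simp: lookup_single when_def in_keys_iff\<close>)+
  show "mdeg (a - single w 1) \<in> S"
    using mdeg_in_monoid[OF assms(1)] * assms(2) by blast
  show "mdeg a = mdeg (a - single w 1) + w"
    using mdeg_add[of "single w 1" "a - single w 1"] *(1) by simp
qed

text \<open>If \<open>d\<close> is the common degree of \<open>a\<close> and \<open>b\<close> and \<open>q = a - b\<close>, then \<open>d - w\<close> is in \<open>S\<close> for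
  each \<open>w\<close> in the support of \<open>q\<close>, and so is \<open>d - \<pi>(q\<^sup>+)\<close>. Hence \<open>d + u \<notin> S\<close> implies \<open>u + w \<notin> S\<close> and
  \<open>\<pi>(q\<^sup>+) + u \<notin> S\<close>. In particular the condition on the support in the definition of the
  vanishing relations is automatic.\<close>

lemma diff_in_vanishing_rels:
  assumes gen: "generates F S" and ab: "keys a \<subseteq> F" "keys b \<subseteq> F" "mdeg a = mdeg b"
    and d: "mdeg a + u \<notin> S"
  shows "zvec a - zvec b \<in> vanishing_rels S F u"
proof -
  let ?q = "zvec a - zvec b"
  have excl: "w \<in> excl S F u" if c: "w \<in> keys c" "keys c \<subseteq> F" "mdeg c = mdeg a" for w c
  proof -
    obtain x where "x \<in> S" "mdeg c = x + w"
      using monoid_sub_key[OF gen c(2,1)] .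
    then have "u + w \<notin> S"
      using d c(3) monoid_add[OF gen, of x "u + w"] by (auto simp: algebra_simps)
    then show ?thesis using c by (auto simp: excl_def)
  qed
  have "keys ?q \<subseteq> excl S F u"
    using keys_diff[of "zvec a" "zvec b"] excl[of _ a] excl[of _ b] ab by auto
  moreover have "proj ?q = 0"
    using ab by (simp add: proj_diff mdeg_def)
  moreover have "rel_bar ?q + u \<notin> S"
  proof
    assume *: "rel_bar ?q + u \<in> S"
    have le: "lookup (pos_part ?q) x \<le> lookup a x" for x
      by (simp add: lookup_pos_part lookup_minus lookup_map_zero)
    then have "mdeg (a - pos_part ?q) \<in> S"
      using sub_vector(2)[OF le] ab by (intro mdeg_in_monoid[OF gen]) auto
    moreover have "mdeg a = rel_bar ?q + mdeg (a - pos_part ?q)"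
      using mdeg_add[of "pos_part ?q" "a - pos_part ?q"] sub_vector(1)[OF le]
      by (simp add: rel_bar_eq)
    ultimately show False
      using monoid_add[OF gen *, of "mdeg (a - pos_part ?q)"] d by (simp add: add_ac)
  qed
  ultimately show ?thesis by (simp add: vanishing_rels_def int_rel_def)
qed

lemma excl_antimono:
  assumes "generates F S" "w \<in> S"
  shows "excl S F (u + w) \<subseteq> excl S F u"
  using assms monoid_add[OF assms(1), of _ w] by (fastforce simp: excl_def algebra_simps)

lemma rel_space_antimono:
  assumes "generates F S" "w \<in> S"
  shows "rel_space S F (u + w) \<subseteq> rel_space S F u"
  using excl_antimono[OF assms] by (auto simp: rel_space_def k_rel_def)

lemma rel_sub_antimono:
  assumes "generates F S" "w \<in> S"
  shows "rel_sub S F (u + w) \<subseteq> rel_sub S F u"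
proof -
  have "vanishing_rels S F (u + w) \<subseteq> vanishing_rels S F u"
    using excl_antimono[OF assms] monoid_add[OF assms(1), of _ w] assms(2)
    by (fastforce simp: vanishing_rels_def int_rel_def algebra_simps)
  then show ?thesis
    unfolding rel_sub_eq k_span_int_def
    by (intro kvs.span_mono image_mono)
qed

section \<open>Change of generators\<close>

text \<open>The relations of two generating sets \<open>F\<close> and \<open>F'\<close> are compared by writing every \<open>e \<in> F\<close> as
  the degree of an exponent vector on \<open>F'\<close>. The resulting maps \<open>\<int>\<^sup>F \<rightarrow> \<int>\<^bsup>F'\<^esup>\<close> depend on choices, but
  modulo vanishing relations two choices agree and the maps for \<open>(F, F')\<close> and \<open>(F', F)\<close> are
  inverse to each other.\<close>

definition expresses ::
  "'m::ab_group_add set \<Rightarrow> 'm set \<Rightarrow> ('m \<Rightarrow> 'm \<Rightarrow>\<^sub>0 nat) \<Rightarrow> bool" where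
  "expresses F F' r \<longleftrightarrow> (\<forall>e\<in>F. keys (r e) \<subseteq> F' \<and> mdeg (r e) = e)"

definition subst :: "('m \<Rightarrow> 'm \<Rightarrow>\<^sub>0 nat) \<Rightarrow> ('m \<Rightarrow>\<^sub>0 'k::field) \<Rightarrow> 'm \<Rightarrow>\<^sub>0 'k" where
  "subst r = lext (\<lambda>e. kvec (zvec (r e)))"

lemma expresses_exists:
  fixes S F F' :: "'m::ab_group_add set"
  assumes "generates F S" "generates F' S"
  obtains r where "expresses F F' r"
proof -
  have "\<exists>a. keys a \<subseteq> F' \<and> mdeg a = e" if "e \<in> F" for e
    using mdeg_in_monoid[OF assms(1), of "single e (Suc 0)"] that assms(2)
    by (auto simp: generates_def)
  then show thesis using that unfolding expresses_def by metis
qed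

lemma subst_zvec:
  assumes r: "expresses F F' r" and a: "keys a \<subseteq> F"
  obtains b where "keys b \<subseteq> F'" "mdeg b = mdeg a"
    "subst r (kvec (zvec a)) = (kvec (zvec b) :: 'm::ab_group_add \<Rightarrow>\<^sub>0 'k::field)"
proof -
  let ?P = "\<lambda>a. \<exists>b. keys b \<subseteq> F' \<and> mdeg b = mdeg a \<and>
    subst r (kvec (zvec a)) = (kvec (zvec b) :: 'm \<Rightarrow>\<^sub>0 'k)"
  have zero: "?P 0"
    by (rule exI[of _ 0]) (simp add: subst_def map_eq_zero_iff[THEN iffD2])
  have add: "?P (a + a')" if aa: "?P a" "?P a'" for a a'
  proof -
    from aa obtain b b' where "keys b \<subseteq> F'" "mdeg b = mdeg a"
      "subst r (kvec (zvec a)) = (kvec (zvec b) :: 'm \<Rightarrow>\<^sub>0 'k)"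
      "keys b' \<subseteq> F'" "mdeg b' = mdeg a'"
      "subst r (kvec (zvec a')) = (kvec (zvec b') :: 'm \<Rightarrow>\<^sub>0 'k)" by auto
    then show ?thesis
      using keys_add[of b b']
      by (intro exI[of _ "b + b'"]) (auto simp: mdeg_add zvec_add kvec_add subst_def lext_add)
  qed
  have one: "?P (single e (Suc 0))" if "e \<in> F" for e
    using that r by (intro exI[of _ "r e"]) (auto simp: expresses_def subst_def)
  have "?P (single e n)" if "e \<in> F" for e n
  proof (induction n)
    case (Suc n)
    have "single e (Suc n) = single e (Suc 0) + single e n"
      by (simp flip: single_add)
    then show ?case using add[OF one[OF that] Suc] by simp
  qed (use zero in simp)
  then have "keys a \<subseteq> F \<longrightarrow> ?P a"
  proof (induction a rule: poly_mapping_add_induct)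
    case (single x m)
    then show ?case using zero by (cases "m = 0") auto
  next
    case (add c d)
    have "keys (c + d) = keys c \<union> keys d"
      by (auto simp: in_keys_iff lookup_add)
    then show ?case using add \<open>\<And>a a'. ?P a \<Longrightarrow> ?P a' \<Longrightarrow> ?P (a + a')\<close> by auto
  qed (use zero in simp)
  then show thesis using a that by auto
qed

text \<open>If \<open>e\<close> is a sum of elements of \<open>F' \<subseteq> S\<close>, one of which is \<open>w\<close>, then \<open>u + w \<in> S\<close> implies
  \<open>u + e \<in> S\<close>. So the substitution preserves the restriction on the supports. It preserves
  relations because it does not change the image in \<open>M \<otimes> k\<close>.\<close>

lemma subst_rel_space:
  assumes gen: "generates F' S" and r: "expresses F F' r" and c: "c \<in> rel_space S F u"
  shows "subst r c \<in> rel_space S F' u"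
proof -
  have keys: "keys c \<subseteq> excl S F u" and rel: "c \<in> tensor_rel"
    using c by (auto simp: rel_space_def k_rel_def)
  have "keys (r e) \<subseteq> excl S F' u" if e: "e \<in> excl S F u" for e
  proof
    fix w assume w: "w \<in> keys (r e)"
    have re: "keys (r e) \<subseteq> F'" "mdeg (r e) = e"
      using e r by (auto simp: expresses_def excl_def)
    obtain x where "x \<in> S" "e = x + w"
      using monoid_sub_key[OF gen re(1) w] re by auto
    then have "u + w \<notin> S"
      using e monoid_add[OF gen, of x "u + w"] by (auto simp: excl_def algebra_simps)
    then show "w \<in> excl S F' u" using re w by (auto simp: excl_def)
  qed
  then have "subst r c \<in> {c. keys c \<subseteq> excl S F' u}"
    unfolding subst_def using keys keys_kvec[of "zvec (r _)"]
    by (intro lext_in_subspace subspace_keys) (fastforce simp del: keys_zvec simp: keys_zvec)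
  moreover have "lext (\<lambda>e. single e 1 - kvec (zvec (r e))) c \<in> tensor_rel"
  proof (intro lext_in_subspace subspace_tensor_rel)
    fix e assume "e \<in> keys c"
    then have "proj (zvec (r e)) = e"
      using keys r by (auto simp: expresses_def excl_def mdeg_def)
    then show "single e 1 - kvec (zvec (r e)) \<in> tensor_rel"
      using tensor_rel_single_proj[of "zvec (r e)"] by simp
  qed
  then have "c - subst r c \<in> tensor_rel"
    by (simp add: lext_left_diff subst_def)
  then have "subst r c \<in> tensor_rel"
    using kvs.subspace_diff[OF subspace_tensor_rel rel] by fastforce
  ultimately show ?thesis by (auto simp: rel_space_def k_rel_def)
qed

text \<open>The images of \<open>q\<^sup>+\<close> and \<open>q\<^sup>-\<close> may have a common part. Their degree is still \<open>\<pi>(q\<^sup>+)\<close>, which is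
  what the vanishing of the difference depends on.\<close>

lemma subst_rel_sub:
  assumes gen: "generates F' S" and r: "expresses F F' r" and c: "c \<in> rel_sub S F u"
  shows "subst r c \<in> (rel_sub S F' u :: ('m::ab_group_add \<Rightarrow>\<^sub>0 'k::field) set)"
proof -
  have "c \<in> kvs.span (kvec ` vanishing_rels S F u)"
    using c by (simp add: rel_sub_eq k_span_int_def)
  then have "c \<in> {c. subst r c \<in> rel_sub S F' u}"
  proof (rule kvs.span_induct[where P = "\<lambda>c. c \<in> {c. subst r c \<in> rel_sub S F' u}"])
    show "kvs.subspace {c. c \<in> {c. subst r c \<in> rel_sub S F' u}}"
      using subspace_rel_sub[of S F' u]
      by (auto simp: kvs.subspace_def subst_def lext_add lext_kscale)
  next
    fix x :: "'m \<Rightarrow>\<^sub>0 'k" assume "x \<in> kvec ` vanishing_rels S F u"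
    then obtain q where q: "x = kvec q" "q \<in> vanishing_rels S F u" by auto
    then have keys: "keys q \<subseteq> F" and proj: "proj q = 0" and bar: "mdeg (pos_part q) + u \<notin> S"
      by (auto simp: vanishing_rels_def int_rel_def excl_def rel_bar_eq)
    obtain a where a: "keys a \<subseteq> F'" "mdeg a = mdeg (pos_part q)"
      "subst r (kvec (zvec (pos_part q))) = (kvec (zvec a) :: 'm \<Rightarrow>\<^sub>0 'k)"
      using subst_zvec[OF r, of "pos_part q", where 'k = 'k] keys_pos_part[of q] keys by blast
    obtain b where b: "keys b \<subseteq> F'" "mdeg b = mdeg (pos_part (- q))"
      "subst r (kvec (zvec (pos_part (- q)))) = (kvec (zvec b) :: 'm \<Rightarrow>\<^sub>0 'k)"
      using subst_zvec[OF r, of "pos_part (- q)", where 'k = 'k] keys_pos_part[of q] keys by blast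
    have "kvec q = (kvec (zvec (pos_part q)) - kvec (zvec (pos_part (- q))) :: 'm \<Rightarrow>\<^sub>0 'k)"
      by (simp add: pos_part_diff flip: kvec_diff)
    then have "subst r (kvec q) = (kvec (zvec a - zvec b) :: 'm \<Rightarrow>\<^sub>0 'k)"
      using a(3) b(3) by (simp add: subst_def lext_diff kvec_diff)
    moreover have "zvec a - zvec b \<in> vanishing_rels S F' u"
      using a b bar mdeg_pos_part_minus[OF proj]
      by (intro diff_in_vanishing_rels[OF gen]) auto
    ultimately show "x \<in> {c. subst r c \<in> rel_sub S F' u}"
      using q by (auto simp: rel_sub_eq k_span_int_def intro: kvs.span_base)
  qed
  then show ?thesis by simp
qed

text \<open>Substituting twice replaces a generator \<open>e\<close> by a vector \<open>b\<close> of the same degree \<open>e\<close>. If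
  \<open>u + e \<notin> S\<close>, then \<open>b - e\<close> is a vanishing relation.\<close>

lemma subst_subst:
  assumes gen: "generates F S" and r: "expresses F F' r" and r': "expresses F' F r'"
    and c: "c \<in> rel_space S F u"
  shows "subst r' (subst r c) - c \<in> (rel_sub S F u :: ('m::ab_group_add \<Rightarrow>\<^sub>0 'k::field) set)"
proof -
  have "subst r' (subst r c) - c = lext (\<lambda>e. subst r' (kvec (zvec (r e))) - single e 1) c"
    by (simp add: lext_left_diff) (simp add: subst_def lext_lext)
  moreover have "\<dots> \<in> rel_sub S F u"
  proof (intro lext_in_subspace subspace_rel_sub)
    fix e assume "e \<in> keys c"
    then have e: "e \<in> F" "u + e \<notin> S"
      using c by (auto simp: rel_space_def k_rel_def excl_def)
    then have re: "keys (r e) \<subseteq> F'" "mdeg (r e) = e"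
      using r by (auto simp: expresses_def)
    obtain b where b: "keys b \<subseteq> F" "mdeg b = e"
      "subst r' (kvec (zvec (r e))) = (kvec (zvec b) :: 'm \<Rightarrow>\<^sub>0 'k)"
      using subst_zvec[OF r' re(1), where 'k = 'k] re(2) by metis
    have "zvec b - zvec (single e 1) \<in> vanishing_rels S F u"
      using b e by (intro diff_in_vanishing_rels[OF gen]) (auto simp: add.commute)
    moreover have "subst r' (kvec (zvec (r e))) - single e 1 =
        (kvec (zvec b - zvec (single e 1)) :: 'm \<Rightarrow>\<^sub>0 'k)"
      using b by (simp add: kvec_diff)
    ultimately show "subst r' (kvec (zvec (r e))) - single e 1 \<in>
        (rel_sub S F u :: ('m \<Rightarrow>\<^sub>0 'k) set)"
      unfolding rel_sub_eq k_span_int_def by (auto intro!: kvs.span_base simp del: single_one)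
  qed
  ultimately show ?thesis by simp
qed

section \<open>Cosets\<close>

definition add_subgroup :: "'a::ab_group_add set \<Rightarrow> bool" where
  "add_subgroup V \<longleftrightarrow> 0 \<in> V \<and> (\<forall>x\<in>V. \<forall>y\<in>V. x - y \<in> V)"

lemma add_subgroupD:
  assumes "add_subgroup V"
  shows "0 \<in> V" "x \<in> V \<Longrightarrow> y \<in> V \<Longrightarrow> x - y \<in> V" "x \<in> V \<Longrightarrow> - x \<in> V"
    "x \<in> V \<Longrightarrow> y \<in> V \<Longrightarrow> x + y \<in> V"
proof -
  show *: "0 \<in> V" and **: "\<And>x y. x \<in> V \<Longrightarrow> y \<in> V \<Longrightarrow> x - y \<in> V"
    using assms by (auto simp: add_subgroup_def)
  show ***: "- x \<in> V" if "x \<in> V" for x using **[OF * that] by simp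
  show "x + y \<in> V" if "x \<in> V" "y \<in> V" using **[OF that(1) ***[OF that(2)]] by simp
qed

lemma subspace_add_subgroup: "kvs.subspace V \<Longrightarrow> add_subgroup V"
  by (simp add: add_subgroup_def kvs.subspace_0 kvs.subspace_diff)

lemma mem_coset: "y \<in> coset V x \<longleftrightarrow> y - x \<in> V"
  by (force simp: coset_def)

lemma coset_self: "add_subgroup V \<Longrightarrow> x \<in> coset V x"
  by (simp add: mem_coset add_subgroupD)

lemma coset_eq_iff:
  assumes "add_subgroup V"
  shows "coset V x = coset V y \<longleftrightarrow> x - y \<in> V"
proof
  assume "coset V x = coset V y"
  then show "x - y \<in> V" using coset_self[OF assms, of x] by (simp add: mem_coset)
next
  assume xy: "x - y \<in> V"
  have "z - x \<in> V \<longleftrightarrow> z - y \<in> V" for z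
    using add_subgroupD(4)[OF assms _ xy, of "z - x"] add_subgroupD(2)[OF assms _ xy, of "z - y"]
    by auto
  then show "coset V x = coset V y" by (auto simp: mem_coset)
qed

lemma qadd_coset:
  assumes "add_subgroup V"
  shows "qadd V (coset V x) (coset V y) = coset V (x + y)"
proof -
  have "coset V (x' + y') = coset V (x + y)" if "x' \<in> coset V x" "y' \<in> coset V y" for x' y'
    using add_subgroupD(4)[OF assms, of "x' - x" "y' - y"] that
    by (simp add: coset_eq_iff[OF assms] mem_coset algebra_simps)
  then show ?thesis using coset_self[OF assms] unfolding qadd_def by blast
qed

lemma qmap_coset:
  assumes "add_subgroup V" "\<And>x y. f (x + y) = f x + f y" "\<And>x. x \<in> V \<Longrightarrow> f x \<in> V"
  shows "qmap V f (coset V x) = coset V (f x)"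
proof -
  have "coset V (f x') = coset V (f x)" if "x' \<in> coset V x" for x'
    using assms(2)[of "x' - x" x] assms(3)[of "x' - x"] that
    by (simp add: coset_eq_iff[OF assms(1)] mem_coset)
  then show ?thesis using coset_self[OF assms(1)] unfolding qmap_def by blast
qed

lemma the_elem_image_coset:
  assumes "add_subgroup V" "\<And>y. y \<in> coset V x \<Longrightarrow> f y = f x"
  shows "the_elem (f ` coset V x) = f x"
proof -
  have "f ` coset V x = {f x}"
    using coset_self[OF assms(1), of x] assms(2) by blast
  then show ?thesis by simp
qed

section \<open>The ideal of a presentation\<close>

abbreviation nval :: "('m \<Rightarrow> 'k::field) \<Rightarrow> ('m \<Rightarrow>\<^sub>0 nat) \<Rightarrow> 'k" where
  "nval \<phi> a \<equiv> pair \<phi> (kvec (zvec a))"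

text \<open>The derivation \<open>\<Sum>\<^sub>w \<phi>(w) \<chi>\<^sup>u\<^sup>+\<^sup>w \<partial>/\<partial>z\<^sub>w\<close> from the polynomial ring to the group algebra.\<close>

definition der :: "'m::ab_group_add \<Rightarrow> ('m \<Rightarrow> 'k::field) \<Rightarrow> ('m, 'k) mpol \<Rightarrow> 'm \<Rightarrow>\<^sub>0 'k" where
  "der u \<phi> f = (\<Sum>a\<in>keys f. single (mdeg a + u) (lookup f a * nval \<phi> a))"

definition binomial :: "('m \<Rightarrow>\<^sub>0 nat) \<Rightarrow> ('m \<Rightarrow>\<^sub>0 nat) \<Rightarrow> ('m, 'k::field) mpol" where
  "binomial a b = single a 1 - single b 1"

lemma pres_add: "pres (f + g) = pres f + pres g"
  unfolding pres_def by (rule sum_keys_add) (rule single_add)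

lemma pres_zero [simp]: "pres 0 = 0"
  by (simp add: pres_def)

lemma pres_diff: "pres (f - g) = pres f - pres g"
  using pres_add[of "f - g" g] by simp

lemma pres_single [simp]: "pres (single a c) = single (mdeg a) c"
  by (cases "c = 0") (auto simp: pres_def)

lemma der_add: "der u \<phi> (f + g) = der u \<phi> f + der u \<phi> g"
  unfolding der_def by (rule sum_keys_add) (simp add: algebra_simps single_add)

lemma der_zero [simp]: "der u \<phi> 0 = 0"
  by (simp add: der_def)

lemma der_diff: "der u \<phi> (f - g) = der u \<phi> f - der u \<phi> g"
  using der_add[of u \<phi> "f - g" g] by simp

lemma der_single [simp]: "der u \<phi> (single a c) = single (mdeg a + u) (c * nval \<phi> a)"
  by (cases "c = 0") (auto simp: der_def)

lemma nval_add: "nval \<phi> (a + b) = nval \<phi> a + nval \<phi> b"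
  by (simp add: zvec_add kvec_add pair_add)

lemma pres_mult: "pres (f * g) = pres f * pres g"
proof (induction f rule: poly_mapping_add_induct)
  case (single a c)
  show ?case
    by (induction g rule: poly_mapping_add_induct)
      (simp_all add: mult_single mdeg_add distrib_left pres_add)
qed (simp_all add: distrib_right pres_add)

lemma der_mult: "der u \<phi> (f * g) = pres f * der u \<phi> g + pres g * der u \<phi> f"
proof (induction f rule: poly_mapping_add_induct)
  case (single a c)
  show ?case
  proof (induction g rule: poly_mapping_add_induct)
    case (single b d)
    have deg: "mdeg a + (mdeg b + u) = mdeg (a + b) + u" "mdeg b + (mdeg a + u) = mdeg (a + b) + u"
      by (simp_all add: mdeg_add add_ac)
    have coeff: "c * d * nval \<phi> (a + b) = c * (d * nval \<phi> b) + d * (c * nval \<phi> a)"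
      unfolding nval_add by algebra
    show ?case
      by (simp only: mult_single der_single pres_single deg coeff single_add)
  next
    case (add g g')
    then show ?case by (simp add: distrib_left distrib_right pres_add der_add add_ac)
  qed simp
next
  case (add f f')
  then show ?case by (simp add: distrib_left distrib_right pres_add der_add add_ac)
qed simp

lemma pol_ring_single: "keys a \<subseteq> W \<Longrightarrow> single a c \<in> pol_ring W"
  by (simp add: pol_ring_def)

lemma pol_ring_zero: "0 \<in> pol_ring W"
  by (simp add: pol_ring_def)

lemma pol_ring_diff: "f \<in> pol_ring W \<Longrightarrow> g \<in> pol_ring W \<Longrightarrow> f - g \<in> pol_ring W"
  using keys_diff[of f g] by (auto simp: pol_ring_def)

lemma pol_ring_mult: "f \<in> pol_ring W \<Longrightarrow> g \<in> pol_ring W \<Longrightarrow> f * g \<in> pol_ring W"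
  using keys_mult[of f g] by (fastforce simp: pol_ring_def dest!: subsetD[OF keys_add])

lemma add_subgroup_pres_ideal: "add_subgroup (pres_ideal W)"
  by (auto simp: add_subgroup_def pres_ideal_def pol_ring_zero pol_ring_diff pres_diff)

lemma pres_ideal_mult: "r \<in> pol_ring W \<Longrightarrow> f \<in> pres_ideal W \<Longrightarrow> r * f \<in> pres_ideal W"
  by (auto simp: pres_ideal_def pol_ring_mult pres_mult)

lemma add_subgroup_pres_ideal_sq: "add_subgroup (pres_ideal_sq W)"
  by (auto simp: add_subgroup_def pres_ideal_sq_def group_closure.diff)

lemma pres_ideal_sq_mult:
  assumes "r \<in> pol_ring W" "f \<in> pres_ideal_sq W"
  shows "r * f \<in> pres_ideal_sq W"
  using assms(2) unfolding pres_ideal_sq_def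
proof induction
  case (base s)
  then consider "s = 0" | f g where "s = f * g" "f \<in> pres_ideal W" "g \<in> pres_ideal W" by auto
  then show ?case
  proof cases
    case 2
    then have "r * s = (r * f) * g" "r * f \<in> pres_ideal W"
      using pres_ideal_mult[OF assms(1)] by (auto simp: mult.assoc)
    then show ?thesis using 2 by (intro group_closure.base) blast
  qed simp
next
  case (diff s t)
  then show ?case by (simp add: right_diff_distrib group_closure.diff)
qed

lemma binomial_in_pres_ideal:
  fixes W :: "'m::ab_group_add set"
  assumes "keys a \<subseteq> W" "keys b \<subseteq> W" "mdeg a = mdeg b"
  shows "binomial a b \<in> (pres_ideal W :: ('m, 'k::field) mpol set)"
  using assms
  by (simp add: binomial_def pres_ideal_def pol_ring_single pol_ring_diff pres_diff)

lemma der_binomial: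
  "mdeg a = mdeg b \<Longrightarrow> der u \<phi> (binomial a b) = single (mdeg a + u) (nval \<phi> a - nval \<phi> b)"
  by (simp add: binomial_def der_diff single_diff)

text \<open>The ideal is spanned by binomials: the coefficients of an element of the ideal at the
  monomials of one degree add up to zero, so a term can be moved to another monomial of the
  same degree until none is left.\<close>

lemma pres_ideal_induct [consumes 1, case_names zero add]:
  fixes f :: "('m::ab_group_add, 'k::field) mpol"
  assumes "f \<in> pres_ideal W" and zero: "P 0"
    and add: "\<And>f c a b. f \<in> pres_ideal W \<Longrightarrow> P f \<Longrightarrow> keys a \<subseteq> W \<Longrightarrow> keys b \<subseteq> W \<Longrightarrow> mdeg a = mdeg b
      \<Longrightarrow> P (f + single 0 c * binomial a b)"
  shows "P f"
  using assms(1)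
proof (induction "card (keys f)" arbitrary: f rule: less_induct)
  case less
  show ?case
  proof (cases "f = 0")
    case False
    then obtain a where a: "a \<in> keys f" by (auto simp flip: keys_eq_empty)
    let ?c = "lookup f a"
    have W: "keys b \<subseteq> W" if "b \<in> keys f" for b
      using less(2) that by (auto simp: pres_ideal_def pol_ring_def)
    have "\<exists>b\<in>keys f. b \<noteq> a \<and> mdeg b = mdeg a"
    proof (rule ccontr)
      assume "\<not> ?thesis"
      then have "lookup (pres f) (mdeg a) = (\<Sum>b\<in>keys f. if b = a then lookup f b else 0)"
        unfolding pres_def lookup_sum
        by (intro sum.cong) (auto simp: lookup_single when_def)
      also have "\<dots> = lookup f a" using a by simp
      finally show False using a less(2) by (auto simp: pres_ideal_def in_keys_iff)
    qed
    then obtain b where b: "b \<in> keys f" "b \<noteq> a" "mdeg b = mdeg a" by auto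
    let ?g = "single 0 ?c * binomial a b"
    have g: "?g = single a ?c - single b ?c"
      by (simp add: binomial_def right_diff_distrib mult_single)
    have "?g \<in> pres_ideal W"
      using W[OF a] W[OF b(1)] b(3)
      by (intro pres_ideal_mult pol_ring_single binomial_in_pres_ideal) auto
    then have I: "f - ?g \<in> pres_ideal W"
      using add_subgroupD(2)[OF add_subgroup_pres_ideal less(2)] by blast
    have "keys (f - ?g) \<subseteq> keys f - {a}"
      using a b by (auto simp: g in_keys_iff lookup_minus lookup_single when_def split: if_splits)
    then have "card (keys (f - ?g)) < card (keys f)"
      using a by (intro psubset_card_mono) auto
    then have "P (f - ?g)" using less(1) I by blast
    then have "P (f - ?g + ?g)"
      using I W[OF a] W[OF b(1)] b(3) by (intro add) auto
    then show ?thesis by simp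
  qed (use zero in simp)
qed

section \<open>Homomorphisms on the conormal module\<close>

lemma conormal_hom_coset:
  assumes h: "h \<in> conormal_hom S W" and f: "f \<in> pres_ideal W"
  shows "g \<in> pres_ideal W \<Longrightarrow> h (coset (pres_ideal_sq W) (f + g)) =
      h (coset (pres_ideal_sq W) f) + h (coset (pres_ideal_sq W) g)"
    and "r \<in> pol_ring W \<Longrightarrow> h (coset (pres_ideal_sq W) (r * f)) = pres r * h (coset (pres_ideal_sq W) f)"
    and "h (coset (pres_ideal_sq W) f) \<in> monoid_alg S"
proof -
  have con: "coset (pres_ideal_sq W) f \<in> conormal W" if "f \<in> pres_ideal W" for f
    using that by (simp add: quot_def)
  note V = add_subgroup_pres_ideal_sq[of W]
  show "h (coset (pres_ideal_sq W) (f + g)) =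
      h (coset (pres_ideal_sq W) f) + h (coset (pres_ideal_sq W) g)" if "g \<in> pres_ideal W"
    using h con[OF f] con[OF that] by (simp add: conormal_hom_def qadd_coset[OF V, symmetric])
  show "h (coset (pres_ideal_sq W) (r * f)) = pres r * h (coset (pres_ideal_sq W) f)"
    if "r \<in> pol_ring W"
    using h con[OF f] that
      qmap_coset[OF V, of "(*) r" f, OF distrib_left pres_ideal_sq_mult[OF that], symmetric]
    by (simp add: conormal_hom_def)
  show "h (coset (pres_ideal_sq W) f) \<in> monoid_alg S"
    using h con[OF f] by (simp add: conormal_hom_def)
qed

lemma conormal_hom_zero_coset:
  assumes "h \<in> conormal_hom S W"
  shows "h (coset (pres_ideal_sq W) 0) = 0"
  using conormal_hom_coset(1)[OF assms, of 0 0] add_subgroupD(1)[OF add_subgroup_pres_ideal, of W]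
  by simp

lemma conormal_hom_eqI:
  assumes "h \<in> conormal_hom S W" "g \<in> conormal_hom S W"
    and "\<And>f. f \<in> pres_ideal W \<Longrightarrow> h (coset (pres_ideal_sq W) f) = g (coset (pres_ideal_sq W) f)"
  shows "h = g"
proof
  fix X
  show "h X = g X"
    using assms by (cases "X \<in> conormal W") (auto simp: conormal_hom_def quot_def)
qed

definition induced_hom ::
  "'m::ab_group_add set \<Rightarrow> (('m, 'k::field) mpol \<Rightarrow> 'm \<Rightarrow>\<^sub>0 'k) \<Rightarrow> ('m, 'k) mpol set \<Rightarrow> 'm \<Rightarrow>\<^sub>0 'k" where
  "induced_hom W D = (\<lambda>X. if X \<in> conormal W then the_elem (D ` X) else 0)"

lemma der_pres_ideal_mult:
  assumes "f \<in> pres_ideal W"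
  shows "der u \<phi> (r * f) = pres r * der u \<phi> f"
  using assms by (simp add: der_mult pres_ideal_def)

lemma der_pres_ideal_sq: "f \<in> pres_ideal_sq W \<Longrightarrow> der u \<phi> f = 0"
  unfolding pres_ideal_sq_def
  by (induction rule: group_closure.induct) (auto simp: der_diff der_mult pres_ideal_def)

lemma induced_hom_der_coset:
  assumes "f \<in> pres_ideal W"
  shows "induced_hom W (der u \<phi>) (coset (pres_ideal_sq W) f) = der u \<phi> f"
proof -
  have "der u \<phi> g = der u \<phi> f" if "g \<in> coset (pres_ideal_sq W) f" for g
    using der_pres_ideal_sq[of "g - f" W u \<phi>] that by (simp add: mem_coset der_diff)
  then show ?thesis using assms
    by (simp add: induced_hom_def quot_def the_elem_image_coset[OF add_subgroup_pres_ideal_sq])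
qed

lemma hom_degree_induced_der:
  fixes \<phi> :: "'m::ab_group_add \<Rightarrow> 'k::field"
  shows "hom_degree W u (induced_hom W (der u \<phi>))"
  unfolding hom_degree_def
proof (intro allI ballI impI)
  fix d and f :: "('m, 'k) mpol"
  assume "f \<in> pres_ideal W" and d: "\<forall>a\<in>keys f. mdeg a = d"
  have "der u \<phi> f \<in> {c. keys c \<subseteq> {d + u}}"
    unfolding der_def using d by (intro kvs.subspace_sum subspace_keys) auto
  then show "keys (induced_hom W (der u \<phi>) (coset (pres_ideal_sq W) f)) \<subseteq> {d + u}"
    using \<open>f \<in> pres_ideal W\<close> by (simp add: induced_hom_der_coset)
qed

lemma monoid_alg_add: "f \<in> monoid_alg S \<Longrightarrow> g \<in> monoid_alg S \<Longrightarrow> f + g \<in> monoid_alg S"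
  by (simp add: monoid_alg_def keys_add_subset)

lemma monoid_alg_mult:
  assumes "generates W S" "f \<in> monoid_alg S" "g \<in> monoid_alg S"
  shows "f * g \<in> monoid_alg S"
  using keys_mult[of f g] assms(2,3) monoid_add[OF assms(1)] by (fastforce simp: monoid_alg_def)

lemma zero_in_monoid: "generates W S \<Longrightarrow> 0 \<in> S"
  using mdeg_in_monoid[of W S 0] by simp

text \<open>On a binomial of degree \<open>d\<close> the derivation takes values in \<open>k \<chi>\<^sup>d\<^sup>+\<^sup>u\<close>. If \<open>d + u \<notin> S\<close>, then
  the value is zero because the difference of the exponents is a vanishing relation. So the
  restriction to the ideal takes values in \<open>k[S]\<close>, although the derivation itself does not.\<close>

lemma induced_der_conormal_hom:
  fixes W S :: "'m::ab_group_add set" and \<phi> :: "'m \<Rightarrow> 'k::field"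
  assumes gen: "generates W S"
    and \<phi>: "\<And>q. q \<in> vanishing_rels S W u \<Longrightarrow> pair \<phi> (kvec q) = 0"
  shows "induced_hom W (der u \<phi>) \<in> conormal_hom S W"
proof -
  have val: "der u \<phi> f \<in> monoid_alg S" if "f \<in> pres_ideal W" for f
    using that
  proof (induction rule: pres_ideal_induct)
    case (add f c a b)
    have "nval \<phi> a - nval \<phi> b = 0" if "mdeg a + u \<notin> S"
      using \<phi>[OF diff_in_vanishing_rels[OF gen add.hyps(2-4) that]] by (simp add: kvec_diff pair_diff)
    then have "der u \<phi> (single 0 c * binomial a b) \<in> monoid_alg S"
      using add.hyps(2-4)
      by (auto simp: der_pres_ideal_mult[OF binomial_in_pres_ideal] der_binomial mult_single
          monoid_alg_def)
    then show ?case using add.IH by (simp add: der_add monoid_alg_add)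
  qed (simp add: monoid_alg_def)
  note V = add_subgroup_pres_ideal_sq[of W]
  have "induced_hom W (der u \<phi>) (qadd (pres_ideal_sq W) X Y) =
      induced_hom W (der u \<phi>) X + induced_hom W (der u \<phi>) Y"
    if "X \<in> conormal W" "Y \<in> conormal W" for X Y
  proof -
    obtain f g where "X = coset (pres_ideal_sq W) f" "f \<in> pres_ideal W"
      "Y = coset (pres_ideal_sq W) g" "g \<in> pres_ideal W"
      using \<open>X \<in> conormal W\<close> \<open>Y \<in> conormal W\<close> by (auto simp: quot_def)
    then show ?thesis
      by (simp add: qadd_coset[OF V] induced_hom_der_coset der_add
          add_subgroupD(4)[OF add_subgroup_pres_ideal])
  qed
  moreover have "induced_hom W (der u \<phi>) (qmap (pres_ideal_sq W) ((*) r) X) =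
      pres r * induced_hom W (der u \<phi>) X" if "r \<in> pol_ring W" "X \<in> conormal W" for r X
  proof -
    obtain f where "X = coset (pres_ideal_sq W) f" "f \<in> pres_ideal W"
      using \<open>X \<in> conormal W\<close> by (auto simp: quot_def)
    then show ?thesis
      using qmap_coset[OF V, of "(*) r" f, OF distrib_left pres_ideal_sq_mult[OF that(1)]]
      by (simp add: induced_hom_der_coset der_pres_ideal_mult pres_ideal_mult[OF that(1)])
  qed
  moreover have "induced_hom W (der u \<phi>) X \<in> monoid_alg S" if "X \<in> conormal W" for X
    using that val by (auto simp: quot_def induced_hom_der_coset)
  moreover have "induced_hom W (der u \<phi>) X = 0" if "X \<notin> conormal W" for X
    using that by (simp add: induced_hom_def)
  ultimately show ?thesis unfolding conormal_hom_def by blast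
qed

lemma additive_eq_pair:
  fixes g :: "('m \<Rightarrow>\<^sub>0 int) \<Rightarrow> 'k::field"
  assumes g: "\<And>c d. keys c \<subseteq> A \<Longrightarrow> keys d \<subseteq> A \<Longrightarrow> g (c + d) = g c + g d" and c: "keys c \<subseteq> A"
  shows "g c = pair (\<lambda>x. g (single x 1)) (kvec c)"
proof -
  have g0: "g 0 = 0"
    using g[of 0 0] by (metis add.right_neutral add_left_cancel empty_subsetI keys_zero)
  have g1: "g (single x n) = g (single x 1) * of_int n" if x: "x \<in> A" for x n
  proof (induction n rule: int_induct[where k = 0])
    case (step1 i)
    then show ?case using g[of "single x i" "single x 1"] x
      by (simp add: single_add algebra_simps)
  next
    case (step2 i)
    then show ?case using g[of "single x (i - 1)" "single x 1"] x
      by (simp add: algebra_simps flip: single_add)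
  qed (simp add: g0)
  have "g (\<Sum>x\<in>B. single x (lookup c x)) = (\<Sum>x\<in>B. g (single x 1) * of_int (lookup c x))"
    if "finite B" "B \<subseteq> A" for B
    using that
  proof induction
    case (insert x B)
    have "keys (\<Sum>x\<in>B. single x (lookup c x)) \<subseteq> A"
      using insert by (intro order_trans[OF keys_sum]) auto
    then have "g (single x (lookup c x) + (\<Sum>x\<in>B. single x (lookup c x))) =
        g (single x (lookup c x)) + g (\<Sum>x\<in>B. single x (lookup c x))"
      using insert.prems by (intro g) auto
    also have "g (single x (lookup c x)) = g (single x 1) * of_int (lookup c x)"
      using insert.prems by (intro g1) auto
    finally show ?case using insert by simp
  qed (simp add: g0)
  from this[of "keys c"] have "g (\<Sum>x\<in>keys c. single x (lookup c x)) =
      (\<Sum>x\<in>keys c. g (single x 1) * of_int (lookup c x))"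
    using c by simp
  moreover have "(\<Sum>x\<in>keys c. single x (lookup c x)) = c"
    by (intro poly_mapping_eqI) (auto simp: lookup_sum lookup_single when_def in_keys_iff)
  moreover have "pair (\<lambda>x. g (single x 1)) (kvec c) =
      (\<Sum>x\<in>keys c. g (single x 1) * of_int (lookup c x))"
    by (subst pair_superset[OF finite_keys keys_kvec]) (simp add: lookup_map_zero)
  ultimately show ?thesis by simp
qed

text \<open>Every homomorphism \<open>h\<close> of degree \<open>u\<close> is the restriction of a derivation. Its value on
  \<open>z\<^sup>a - z\<^sup>b\<close> is a multiple of \<open>\<chi>\<^sup>d\<^sup>+\<^sup>u\<close>, and linearity over the polynomial ring shows that the factor
  \<open>val a b\<close> does not change when a monomial is multiplied to \<open>z\<^sup>a\<close> and \<open>z\<^sup>b\<close>. So it is an additive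
  function of \<open>a - b \<in> L(W)\<close>, and the splitting \<open>s\<close> extends this function to \<open>\<int>\<^sup>W\<close>.\<close>

lemma conormal_hom_eq_der:
  fixes W S :: "'m::ab_group_add set" and h :: "('m, 'k::field) mpol set \<Rightarrow> 'm \<Rightarrow>\<^sub>0 'k"
  assumes gen: "generates W S"
    and s: "\<And>x y. s (x + y) = s x + s y" "\<And>x. keys (s x) \<subseteq> W" "\<And>x. proj (s x) = x"
    and h: "h \<in> conormal_hom S W" "hom_degree W u h"
  obtains \<phi> where
    "\<And>f. f \<in> pres_ideal W \<Longrightarrow> h (coset (pres_ideal_sq W) f) = der u \<phi> f"
    "\<And>q. q \<in> vanishing_rels S W u \<Longrightarrow> pair \<phi> (kvec q) = 0"
proof -
  define H where "H f = h (coset (pres_ideal_sq W) f)" for f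
  define val where "val a b = lookup (H (binomial a b)) (mdeg a + u)" for a b
  have H_binomial: "H (binomial a b) = single (mdeg a + u) (val a b)"
    if "keys a \<subseteq> W" "keys b \<subseteq> W" "mdeg a = mdeg b" for a b
  proof -
    have "\<forall>c\<in>keys (binomial a b :: ('m, 'k) mpol). mdeg c = mdeg a"
      using keys_diff[of "single a (1::'k)" "single b 1"] that by (auto simp: binomial_def)
    then have "keys (H (binomial a b)) \<subseteq> {mdeg a + u}"
      using h(2) binomial_in_pres_ideal[OF that] unfolding hom_degree_def H_def by blast
    then show ?thesis
      by (intro poly_mapping_eqI) (auto simp: val_def lookup_single when_def in_keys_iff)
  qed
  have val_trans: "val a c = val a b + val b c"
    if "keys a \<subseteq> W" "keys b \<subseteq> W" "keys c \<subseteq> W" "mdeg a = mdeg b" "mdeg b = mdeg c" for a b c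
  proof -
    have "H (binomial a b + binomial b c) = H (binomial a b) + H (binomial b c)"
      unfolding H_def using that
      by (intro conormal_hom_coset(1)[OF h(1)] binomial_in_pres_ideal) auto
    moreover have "binomial a b + binomial b c = (binomial a c :: ('m, 'k) mpol)"
      by (simp add: binomial_def)
    ultimately show ?thesis using that by (simp add: val_def lookup_add)
  qed
  have val_shift: "val (a + e) (b + e) = val a b"
    if "keys a \<subseteq> W" "keys b \<subseteq> W" "keys e \<subseteq> W" "mdeg a = mdeg b" for a b e
  proof -
    have "single e 1 * binomial a b = (binomial (a + e) (b + e) :: ('m, 'k) mpol)"
      by (simp add: binomial_def right_diff_distrib mult_single add.commute)
    then have "H (binomial (a + e) (b + e)) = pres (single e 1) * H (binomial a b)"
      unfolding H_def using that
        conormal_hom_coset(2)[OF h(1) binomial_in_pres_ideal pol_ring_single, of a b e 1] by simp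
    then show ?thesis
      using that by (simp add: H_binomial val_def[of "a + e"] mult_single mdeg_add add_ac)
  qed
  define ev where "ev q = val (pos_part q) (pos_part (- q))" for q
  have val_eq_ev: "val a b = ev (zvec a - zvec b)"
    if "keys a \<subseteq> W" "keys b \<subseteq> W" "mdeg a = mdeg b" for a b
  proof -
    let ?q = "zvec a - zvec b"
    have W: "keys (pos_part ?q) \<subseteq> W" "keys (pos_part (- ?q)) \<subseteq> W"
      using keys_pos_part[of ?q] keys_diff_subset[of "zvec a" W "zvec b"] that by auto
    have "proj ?q = 0" using that by (simp add: proj_diff mdeg_def)
    note deg = mdeg_pos_part_minus[OF this]
    (* Multiplying (a, b) by one monomial and (q^+, q^-) by another gives the same pair. *)
    have "a + pos_part (- ?q) = pos_part ?q + b"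
      by (intro poly_mapping_eqI)
        (simp add: lookup_add lookup_pos_part lookup_minus lookup_map_zero)
    then have "val (a + pos_part (- ?q)) (b + pos_part (- ?q)) =
        val (pos_part ?q + b) (pos_part (- ?q) + b)"
      by (simp add: add.commute)
    then show ?thesis using W that deg by (simp add: val_shift ev_def)
  qed
  have ev_add: "ev (q + q') = ev q + ev q'" if "q \<in> int_rel W" "q' \<in> int_rel W" for q q'
  proof -
    let ?p = "pos_part q" and ?n = "pos_part (- q)"
    let ?p' = "pos_part q'" and ?n' = "pos_part (- q')"
    have W: "keys ?p \<subseteq> W" "keys ?n \<subseteq> W" "keys ?p' \<subseteq> W" "keys ?n' \<subseteq> W"
      and deg: "mdeg ?n = mdeg ?p" "mdeg ?n' = mdeg ?p'"
      using keys_pos_part[of q] keys_pos_part[of q'] that mdeg_pos_part_minus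
      by (auto simp: int_rel_def)
    have "val (?p + ?p') (?n + ?n') = val (?p + ?p') (?n + ?p') + val (?p' + ?n) (?n' + ?n)"
      using W deg val_trans[of "?p + ?p'" "?n + ?p'" "?n + ?n'"]
      by (simp add: keys_add_subset mdeg_add add.commute)
    also have "\<dots> = ev q + ev q'"
      using W deg by (simp add: val_shift ev_def)
    finally have "val (?p + ?p') (?n + ?n') = ev q + ev q'" .
    moreover have "zvec (?p + ?p') - zvec (?n + ?n') = q + q'"
      by (simp add: zvec_add add_diff_add pos_part_diff)
    ultimately show ?thesis
      using W deg val_eq_ev[of "?p + ?p'" "?n + ?n'"] by (simp add: keys_add_subset mdeg_add)
  qed
  define g where "g c = ev (c - s (proj c))" for c
  have rel: "c - s (proj c) \<in> int_rel W" if "keys c \<subseteq> W" for c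
    using that s by (simp add: int_rel_def proj_diff keys_diff_subset)
  have g_add: "g (c + d) = g c + g d" if "keys c \<subseteq> W" "keys d \<subseteq> W" for c d
    using ev_add[OF rel[OF that(1)] rel[OF that(2)]]
    by (simp add: g_def proj_add s(1) algebra_simps)
  define \<phi> where "\<phi> w = g (single w 1)" for w
  have s0: "s 0 = 0" using s(1)[of 0 0] by simp
  have ev_eq: "ev q = pair \<phi> (kvec q)" if "q \<in> int_rel W" for q
    using additive_eq_pair[of W g q, OF g_add] that by (simp add: g_def int_rel_def s0 \<phi>_def[abs_def])
  show thesis
  proof (rule that)
    fix f :: "('m, 'k) mpol" assume "f \<in> pres_ideal W"
    then show "h (coset (pres_ideal_sq W) f) = der u \<phi> f"
    proof (induction rule: pres_ideal_induct)
      case zero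
      then show ?case by (simp add: conormal_hom_zero_coset[OF h(1)])
    next
      case (add f c a b)
      note I = binomial_in_pres_ideal[OF add.hyps(2-4), where 'k = 'k]
      have "zvec a - zvec b \<in> int_rel W"
        using add.hyps(2-4) by (simp add: int_rel_def keys_diff_subset proj_diff mdeg_def)
      then have "val a b = nval \<phi> a - nval \<phi> b"
        using add.hyps(2-4) by (simp add: val_eq_ev ev_eq kvec_diff pair_diff)
      then have "h (coset (pres_ideal_sq W) (binomial a b)) = der u \<phi> (binomial a b)"
        using H_binomial[OF add.hyps(2-4)] add.hyps(4) by (simp add: H_def der_binomial)
      then have "h (coset (pres_ideal_sq W) (single 0 c * binomial a b)) =
          der u \<phi> (single 0 c * binomial a b)"
        using conormal_hom_coset(2)[OF h(1) I pol_ring_single, of 0 c]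
        by (simp add: der_pres_ideal_mult[OF I])
      then show ?case
        using conormal_hom_coset(1)[OF h(1) add.hyps(1) pres_ideal_mult[OF pol_ring_single I], of 0 c]
          add.IH
        by (simp add: der_add)
    qed
  next
    fix q assume q: "q \<in> vanishing_rels S W u"
    then have rel: "q \<in> int_rel W" and bar: "mdeg (pos_part q) + u \<notin> S"
      by (auto simp: vanishing_rels_def int_rel_def excl_def rel_bar_eq)
    then have "H (binomial (pos_part q) (pos_part (- q))) \<in> monoid_alg S"
      unfolding H_def using keys_pos_part[of q] mdeg_pos_part_minus[of q]
      by (intro conormal_hom_coset(3)[OF h(1)] binomial_in_pres_ideal) (auto simp: int_rel_def)
    then have "ev q = 0"
      using bar by (auto simp: ev_def val_def monoid_alg_def in_keys_iff)
    then show "pair \<phi> (kvec q) = 0" using ev_eq[OF rel] by simp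
  qed
qed

section \<open>The submodule of the partial derivatives\<close>

text \<open>The truncated difference \<open>a - e\<^sub>w\<close> of exponents has the wrong degree if \<open>w\<close> does not occur in
  \<open>a\<close>, but then its coefficient is zero.\<close>

lemma pres_pderiv_var:
  fixes f :: "('m::ab_group_add, 'k::field) mpol"
  shows "pres (pderiv_var w f) = der (- w) (\<lambda>x. if x = w then 1 else 0) f"
proof -
  let ?\<delta> = "\<lambda>x. if x = w then 1 else 0 :: 'k"
  have "nval ?\<delta> a = of_nat (lookup a w)" for a
    by (simp add: pair_indicator lookup_map_zero)
  moreover have "pres (single (a - single w 1) (of_nat (lookup a w) * lookup f a)) =
      single (mdeg a - w) (lookup f a * of_nat (lookup a w))" for a
  proof (cases "lookup a w = 0")
    case False
    then have "a = single w 1 + (a - single w 1)"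
      by (intro sub_vector(1)) (auto simp: lookup_single when_def)
    then have "mdeg (a - single w 1) = mdeg a - w"
      using mdeg_add[of "single w 1" "a - single w 1"] by simp
    then show ?thesis by (simp add: mult.commute)
  qed simp
  moreover have "pres (\<Sum>a\<in>A. F a) = (\<Sum>a\<in>A. pres (F a))" if "finite A"
    for A :: "('m \<Rightarrow>\<^sub>0 nat) set" and F :: "('m \<Rightarrow>\<^sub>0 nat) \<Rightarrow> ('m, 'k) mpol"
    using that by induction (auto simp: pres_add)
  ultimately show ?thesis by (simp add: pderiv_var_def der_def)
qed

lemma partial_hom_eq: "partial_hom W w = induced_hom W (der (- w) (\<lambda>x. if x = w then 1 else 0))"
  by (rule ext) (simp add: partial_hom_def induced_hom_def pres_pderiv_var)

lemma der_eq_sum: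
  fixes f :: "('m::ab_group_add, 'k::field) mpol"
  assumes "finite W" "f \<in> pol_ring W"
  shows "der u \<phi> f = (\<Sum>w\<in>W. single (u + w) (\<phi> w) * der (- w) (\<lambda>x. if x = w then 1 else 0) f)"
proof -
  have "single (mdeg a + u) (lookup f a * nval \<phi> a) =
      (\<Sum>w\<in>W. single (u + w) (\<phi> w) * single (mdeg a - w) (lookup f a * lookup (kvec (zvec a)) w))"
    if "a \<in> keys f" for a
  proof -
    have "keys (kvec (zvec a) :: 'm \<Rightarrow>\<^sub>0 'k) \<subseteq> W"
      using assms(2) that keys_kvec[of "zvec a"] by (auto simp: pol_ring_def)
    then have "lookup f a * nval \<phi> a = (\<Sum>w\<in>W. \<phi> w * (lookup f a * lookup (kvec (zvec a)) w))"
      using assms(1) by (simp add: pair_superset sum_distrib_left mult.left_commute)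
    moreover have "single (mdeg a + u) (\<Sum>w\<in>A. F w) = (\<Sum>w\<in>A. single (mdeg a + u) (F w))"
      if "finite A" for A and F :: "'m \<Rightarrow> 'k"
      using that by induction (auto simp: single_add)
    ultimately show ?thesis using assms(1)
      by (simp add: mult_single add.commute)
  qed
  then show ?thesis
    unfolding der_def pair_indicator sum_distrib_left by (subst sum.swap) simp
qed

lemma lookup_mult_single: "lookup (f * single y c) x = lookup f (x - y) * (c::'k::field)"
  for y :: "'m::ab_group_add"
  by (induction f rule: poly_mapping_add_induct)
    (auto simp: mult_single lookup_single when_def distrib_right lookup_add)

lemma alg_submodule_der_submodule:
  fixes W S :: "'m::ab_group_add set"
  shows "alg_submodule S (der_submodule S W :: (('m, 'k::field) mpol set \<Rightarrow> 'm \<Rightarrow>\<^sub>0 'k) set)"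
  unfolding der_submodule_def by (rule hull_in) (auto simp: alg_submodule_def)

lemma add_subgroup_der_submodule:
  fixes W S :: "'m::ab_group_add set"
  assumes "generates W S"
  shows "add_subgroup (der_submodule S W :: (('m, 'k::field) mpol set \<Rightarrow> 'm \<Rightarrow>\<^sub>0 'k) set)"
proof -
  note sub = alg_submodule_der_submodule[of S W, where 'k = 'k]
  have "(single 0 (- 1) :: 'm \<Rightarrow>\<^sub>0 'k) \<in> monoid_alg S"
    using zero_in_monoid[OF assms] by (simp add: monoid_alg_def)
  moreover have "alg_smult (single 0 (- 1)) h = - h" for h :: "('m, 'k) mpol set \<Rightarrow> 'm \<Rightarrow>\<^sub>0 'k"
    by (auto simp: alg_smult_def single_uminus)
  ultimately have neg: "- h \<in> der_submodule S W" if "h \<in> der_submodule S W"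
    for h :: "('m, 'k) mpol set \<Rightarrow> 'm \<Rightarrow>\<^sub>0 'k"
    using sub that unfolding alg_submodule_def by metis
  have "h - g \<in> der_submodule S W" if "h \<in> der_submodule S W" "g \<in> der_submodule S W"
    for h g :: "('m, 'k) mpol set \<Rightarrow> 'm \<Rightarrow>\<^sub>0 'k"
    using sub neg that unfolding alg_submodule_def
    by (metis diff_conv_add_uminus)
  then show ?thesis
    using sub by (simp add: add_subgroup_def alg_submodule_def)
qed

lemma sum_partial_in_der_submodule:
  fixes A :: "'m::ab_group_add \<Rightarrow> 'm \<Rightarrow>\<^sub>0 'k::field"
  assumes "finite B" "B \<subseteq> W" "\<And>w. w \<in> B \<Longrightarrow> A w \<in> monoid_alg S"
  shows "(\<lambda>X. \<Sum>w\<in>B. A w * partial_hom W w X) \<in> der_submodule S W"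
  using assms
proof induction
  case empty
  then show ?case
    using alg_submodule_der_submodule[of S W, where 'k = 'k] by (simp add: alg_submodule_def zero_fun_def)
next
  case (insert w B)
  have "partial_hom W w \<in> (der_submodule S W :: (('m, 'k) mpol set \<Rightarrow> 'm \<Rightarrow>\<^sub>0 'k) set)"
    using insert unfolding der_submodule_def by (intro hull_inc) auto
  moreover have "A w \<in> monoid_alg S" using insert by simp
  ultimately have "alg_smult (A w) (partial_hom W w) \<in> der_submodule S W"
    using alg_submodule_der_submodule[of S W, where 'k = 'k] by (simp add: alg_submodule_def)
  then have "alg_smult (A w) (partial_hom W w) + (\<lambda>X. \<Sum>w\<in>B. A w * partial_hom W w X)
      \<in> der_submodule S W"
    using insert alg_submodule_der_submodule[of S W, where 'k = 'k] by (simp add: alg_submodule_def)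
  then show ?case using insert by (simp add: alg_smult_def plus_fun_def)
qed

lemma der_submoduleE:
  fixes h :: "('m::ab_group_add, 'k::field) mpol set \<Rightarrow> 'm \<Rightarrow>\<^sub>0 'k"
  assumes gen: "generates W S" and W: "finite W" and h: "h \<in> der_submodule S W"
  obtains A where "\<And>w. A w \<in> monoid_alg S" "h = (\<lambda>X. \<Sum>w\<in>W. A w * partial_hom W w X)"
proof -
  let ?N = "{h :: ('m, 'k) mpol set \<Rightarrow> 'm \<Rightarrow>\<^sub>0 'k. \<exists>A. (\<forall>w. A w \<in> monoid_alg S) \<and>
    h = (\<lambda>X. \<Sum>w\<in>W. A w * partial_hom W w X)}"
  have "alg_submodule S ?N"
    unfolding alg_submodule_def
  proof (intro conjI ballI)
    show "0 \<in> ?N"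
      by (auto intro!: exI[of _ "\<lambda>_. 0"] simp: monoid_alg_def)
  next
    fix h g assume "h \<in> ?N" "g \<in> ?N"
    then obtain A A' where "\<forall>w. A w \<in> monoid_alg S" "h = (\<lambda>X. \<Sum>w\<in>W. A w * partial_hom W w X)"
      "\<forall>w. A' w \<in> monoid_alg S" "g = (\<lambda>X. \<Sum>w\<in>W. A' w * partial_hom W w X)" by blast
    then show "h + g \<in> ?N"
      by (auto intro!: exI[of _ "\<lambda>w. A w + A' w"]
          simp: monoid_alg_add distrib_right sum.distrib plus_fun_def)
  next
    fix a :: "'m \<Rightarrow>\<^sub>0 'k" and h assume a: "a \<in> monoid_alg S" and "h \<in> ?N"
    then obtain A where "\<forall>w. A w \<in> monoid_alg S" "h = (\<lambda>X. \<Sum>w\<in>W. A w * partial_hom W w X)"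
      by blast
    then show "alg_smult a h \<in> ?N"
      using a
      by (auto intro!: exI[of _ "\<lambda>w. a * A w"]
          simp: monoid_alg_mult[OF gen] alg_smult_def sum_distrib_left mult.assoc)
  qed
  moreover have "partial_hom W ` W \<subseteq> ?N"
  proof safe
    fix w assume w: "w \<in> W"
    have *: "(\<Sum>v\<in>W. (if v = w then 1 else 0) * partial_hom W v X) = (partial_hom W w X :: 'm \<Rightarrow>\<^sub>0 'k)" for X
    proof -
      have "(\<Sum>v\<in>W. (if v = w then 1 else 0) * partial_hom W v X) =
          (\<Sum>v\<in>W. if v = w then (partial_hom W v X :: 'm \<Rightarrow>\<^sub>0 'k) else 0)"
        by (intro sum.cong) auto
      then show ?thesis using W w by simp
    qed
    show "\<exists>A. (\<forall>w. A w \<in> monoid_alg S) \<and>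
        partial_hom W w = (\<lambda>X. \<Sum>v\<in>W. A v * partial_hom W v X :: 'm \<Rightarrow>\<^sub>0 'k)"
      using zero_in_monoid[OF gen] *
      by (intro exI[of _ "\<lambda>v. if v = w then 1 else 0"]) (auto simp: monoid_alg_def)
  qed
  ultimately have "der_submodule S W \<subseteq> ?N"
    unfolding der_submodule_def by (intro hull_minimal)
  then show thesis using h that by blast
qed

lemma induced_der_in_der_submodule:
  fixes \<phi> :: "'m::ab_group_add \<Rightarrow> 'k::field"
  assumes W: "finite W" and \<phi>: "\<And>w. w \<in> excl S W u \<Longrightarrow> \<phi> w = 0"
  shows "induced_hom W (der u \<phi>) \<in> der_submodule S W"
proof -
  have "single (u + w) (\<phi> w) \<in> monoid_alg S" if "w \<in> W" for w
    using \<phi>[of w] that by (auto simp: monoid_alg_def excl_def)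
  then have "(\<lambda>X. \<Sum>w\<in>W. single (u + w) (\<phi> w) * partial_hom W w X) \<in> der_submodule S W"
    using W by (intro sum_partial_in_der_submodule) auto
  moreover have "(\<Sum>w\<in>W. single (u + w) (\<phi> w) * partial_hom W w X) = induced_hom W (der u \<phi>) X" for X
  proof (cases "X \<in> conormal W")
    case True
    then obtain f where f: "X = coset (pres_ideal_sq W) f" "f \<in> pres_ideal W"
      by (auto simp: quot_def)
    then have "f \<in> pol_ring W" by (simp add: pres_ideal_def)
    then show ?thesis
      unfolding f(1) partial_hom_eq induced_hom_der_coset[OF f(2)]
      by (rule der_eq_sum[OF W, symmetric])
  qed (simp add: partial_hom_def induced_hom_def)
  ultimately show ?thesis by simp
qed

text \<open>The component of degree \<open>u\<close> of \<open>\<Sum>\<^sub>w A\<^sub>w \<partial>/\<partial>z\<^sub>w\<close> is the derivation whose coefficients \<open>\<psi>(w)\<close> are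
  those of \<open>\<chi>\<^sup>u\<^sup>+\<^sup>w\<close> in \<open>A\<^sub>w \<in> k[S]\<close>. They are zero for \<open>u + w \<notin> S\<close>.\<close>

lemma der_submodule_binomial:
  fixes h :: "('m::ab_group_add, 'k::field) mpol set \<Rightarrow> 'm \<Rightarrow>\<^sub>0 'k"
  assumes gen: "generates W S" and W: "finite W" and h: "h \<in> der_submodule S W"
  obtains \<psi> where "\<And>w. w \<in> excl S W u \<Longrightarrow> \<psi> w = 0"
    "\<And>a b. keys a \<subseteq> W \<Longrightarrow> keys b \<subseteq> W \<Longrightarrow> mdeg a = mdeg b \<Longrightarrow>
      lookup (h (coset (pres_ideal_sq W) (binomial a b))) (mdeg a + u) =
      pair \<psi> (kvec (zvec a - zvec b))"
proof -
  obtain A where A: "\<And>w. A w \<in> monoid_alg S" and hA: "h = (\<lambda>X. \<Sum>w\<in>W. A w * partial_hom W w X)"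
    using der_submoduleE[OF gen W h] by blast
  let ?\<psi> = "\<lambda>w. lookup (A w) (u + w)"
  show thesis
  proof (rule that[of ?\<psi>])
    show "?\<psi> w = 0" if "w \<in> excl S W u" for w
      using that A[of w] by (auto simp: excl_def monoid_alg_def in_keys_iff)
  next
    fix a b assume ab: "keys a \<subseteq> W" "keys b \<subseteq> W" "mdeg a = mdeg b"
    let ?c = "kvec (zvec a - zvec b) :: 'm \<Rightarrow>\<^sub>0 'k"
    have "keys ?c \<subseteq> W"
      using keys_kvec keys_diff_subset[of "zvec a" W "zvec b"] ab by fastforce
    then have "pair ?\<psi> ?c = (\<Sum>w\<in>W. ?\<psi> w * lookup ?c w)"
      using W by (simp add: pair_superset)
    also have "\<dots> = (\<Sum>w\<in>W. lookup (A w * partial_hom W w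
        (coset (pres_ideal_sq W) (binomial a b))) (mdeg a + u))"
    proof (intro sum.cong refl)
      fix w
      have "partial_hom W w (coset (pres_ideal_sq W) (binomial a b)) = single (mdeg a - w) (lookup ?c w)"
        using ab
        by (simp add: partial_hom_eq induced_hom_der_coset binomial_in_pres_ideal der_binomial
            pair_indicator kvec_diff lookup_minus)
      moreover have "mdeg a + u - (mdeg a - w) = u + w" by simp
      ultimately show "?\<psi> w * lookup ?c w = lookup (A w * partial_hom W w
          (coset (pres_ideal_sq W) (binomial a b))) (mdeg a + u)"
        by (simp only: lookup_mult_single)
    qed
    also have "\<dots> = lookup (h (coset (pres_ideal_sq W) (binomial a b))) (mdeg a + u)"
      by (simp add: hA lookup_sum)
    finally show "lookup (h (coset (pres_ideal_sq W) (binomial a b))) (mdeg a + u) = pair ?\<psi> ?c"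
      by simp
  qed
qed

section \<open>Classes of derivations\<close>

text \<open>The condition under which the derivation with coefficients \<open>\<phi>\<close> restricts to a homomorphism
  into \<open>k[S]\<close>, and the class of the restriction.\<close>

definition kills :: "'m::ab_group_add set \<Rightarrow> 'm set \<Rightarrow> 'm \<Rightarrow> ('m \<Rightarrow> 'k::field) \<Rightarrow> bool" where
  "kills S W u \<phi> \<longleftrightarrow> (\<forall>c\<in>rel_sub S W u. pair \<phi> c = 0)"

definition der_class ::
  "'m::ab_group_add set \<Rightarrow> 'm set \<Rightarrow> 'm \<Rightarrow> ('m \<Rightarrow> 'k::field) \<Rightarrow>
    (('m, 'k) mpol set \<Rightarrow> ('m \<Rightarrow>\<^sub>0 'k)) set" where
  "der_class S W u \<phi> = coset (der_submodule S W) (induced_hom W (der u \<phi>))"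

lemma kills_iff: "kills S W u \<phi> \<longleftrightarrow> (\<forall>q\<in>vanishing_rels S W u. pair \<phi> (kvec q) = 0)"
proof
  assume "kills S W u \<phi>"
  then show "\<forall>q\<in>vanishing_rels S W u. pair \<phi> (kvec q) = 0"
    by (auto simp: kills_def rel_sub_eq k_span_int_def intro: kvs.span_base)
next
  assume "\<forall>q\<in>vanishing_rels S W u. pair \<phi> (kvec q) = 0"
  then show "kills S W u \<phi>"
    unfolding kills_def rel_sub_eq k_span_int_def
    by (intro ballI) (erule pair_span_eq_0[rotated], auto)
qed

lemma kills_add: "kills S W u \<phi> \<Longrightarrow> kills S W u \<psi> \<Longrightarrow> kills S W u (\<lambda>x. \<phi> x + \<psi> x)"
  by (simp add: kills_def pair_left_add)

lemma kills_mult: "kills S W u \<phi> \<Longrightarrow> kills S W u (\<lambda>x. m * \<phi> x)"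
  by (simp add: kills_def pair_left_mult)

lemma kills_mono:
  assumes "generates W S" "w \<in> S" "kills S W u \<phi>"
  shows "kills S W (u + w) \<phi>"
  using rel_sub_antimono[OF assms(1,2)] assms(3) by (auto simp: kills_def)

lemma der_class_in_T1_deg:
  assumes "generates W S" "kills S W u \<phi>"
  shows "der_class S W u \<phi> \<in> T1_deg S W u"
  using induced_der_conormal_hom[OF assms(1), of u \<phi>] assms(2) hom_degree_induced_der[of W u \<phi>]
  by (auto simp: T1_deg_def der_class_def kills_iff)

lemma T1_degE:
  fixes W S :: "'m::ab_group_add set" and t :: "(('m, 'k::field) mpol set \<Rightarrow> 'm \<Rightarrow>\<^sub>0 'k) set"
  assumes gen: "generates W S"
    and s: "\<And>x y. s (x + y) = s x + s y" "\<And>x. keys (s x) \<subseteq> W" "\<And>x. proj (s x) = x"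
    and t: "t \<in> T1_deg S W u"
  obtains \<phi> where "kills S W u \<phi>" "t = der_class S W u \<phi>"
proof -
  obtain h where h: "h \<in> conormal_hom S W" "hom_degree W u h" "t = coset (der_submodule S W) h"
    using t by (auto simp: T1_deg_def)
  obtain \<phi> where \<phi>: "\<And>f. f \<in> pres_ideal W \<Longrightarrow> h (coset (pres_ideal_sq W) f) = der u \<phi> f"
    "\<And>q. q \<in> vanishing_rels S W u \<Longrightarrow> pair \<phi> (kvec q) = 0"
    using conormal_hom_eq_der[where s = s, OF gen s h(1,2)] by blast
  have "h = induced_hom W (der u \<phi>)"
    using \<phi> by (intro conormal_hom_eqI[OF h(1)] induced_der_conormal_hom[OF gen])
      (simp_all add: induced_hom_der_coset)
  then show thesis
    using \<phi>(2) h(3) that by (auto simp: kills_iff der_class_def)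
qed

lemma der_left_add: "der u (\<lambda>x. \<phi> x + \<psi> x) f = der u \<phi> f + der u \<psi> f"
  by (simp add: der_def pair_left_add distrib_left single_add sum.distrib)

lemma der_left_diff: "der u (\<lambda>x. \<phi> x - \<psi> x) f = der u \<phi> f - der u \<psi> f"
  by (simp add: der_def pair_left_diff right_diff_distrib single_diff sum_subtractf)

lemma der_left_mult: "der (u + v) (\<lambda>x. c * \<phi> x) f = single v c * der u \<phi> f"
  by (simp add: der_def pair_left_mult sum_distrib_left mult_single ac_simps)

lemma induced_hom_cong:
  assumes "\<And>f. f \<in> pres_ideal W \<Longrightarrow>
    F (coset (pres_ideal_sq W) f) = induced_hom W D (coset (pres_ideal_sq W) f)"
    and "\<And>X. X \<notin> conormal W \<Longrightarrow> F X = 0"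
  shows "F = induced_hom W D"
proof
  fix X
  show "F X = induced_hom W D X"
    using assms by (cases "X \<in> conormal W") (auto simp: quot_def induced_hom_def)
qed

lemma induced_hom_der_add:
  "induced_hom W (der u \<phi>) + induced_hom W (der u \<psi>) = induced_hom W (der u (\<lambda>x. \<phi> x + \<psi> x))"
  by (rule induced_hom_cong)
    (simp_all add: induced_hom_der_coset der_left_add, simp add: induced_hom_def)

lemma induced_hom_der_diff:
  "induced_hom W (der u \<phi>) - induced_hom W (der u \<psi>) = induced_hom W (der u (\<lambda>x. \<phi> x - \<psi> x))"
  by (rule induced_hom_cong)
    (simp_all add: induced_hom_der_coset der_left_diff, simp add: induced_hom_def)

lemma alg_smult_induced_hom_der:
  "alg_smult (single v c) (induced_hom W (der u \<phi>)) = induced_hom W (der (u + v) (\<lambda>x. c * \<phi> x))"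
  by (rule induced_hom_cong)
    (simp_all add: alg_smult_def induced_hom_der_coset der_left_mult, simp add: induced_hom_def)

lemma T1_add_der_class:
  assumes "generates W S"
  shows "T1_add S W (der_class S W u \<phi>) (der_class S W u \<psi>) = der_class S W u (\<lambda>x. \<phi> x + \<psi> x)"
  by (simp add: der_class_def qadd_coset[OF add_subgroup_der_submodule[OF assms]] induced_hom_der_add)

lemma T1_smult_der_class:
  fixes W S :: "'m::ab_group_add set" and \<phi> :: "'m \<Rightarrow> 'k::field"
  assumes "generates W S" "v \<in> S"
  shows "T1_smult S W (single v c) (der_class S W u \<phi>) = der_class S W (u + v) (\<lambda>x. c * \<phi> x)"
proof -
  have "single v c \<in> monoid_alg S"
    using assms(2) by (simp add: monoid_alg_def)
  then have "alg_smult (single v c) h \<in> der_submodule S W" if "h \<in> der_submodule S W"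
    for h :: "('m, 'k) mpol set \<Rightarrow> 'm \<Rightarrow>\<^sub>0 'k"
    using alg_submodule_der_submodule[of S W] that unfolding alg_submodule_def by blast
  moreover have "alg_smult (single v c) (h + g) = alg_smult (single v c) h + alg_smult (single v c) g"
    for h g :: "('m, 'k) mpol set \<Rightarrow> 'm \<Rightarrow>\<^sub>0 'k"
    by (rule ext) (simp add: alg_smult_def distrib_left)
  ultimately show ?thesis
    unfolding der_class_def
    by (subst qmap_coset[OF add_subgroup_der_submodule[OF assms(1)]])
      (auto simp: alg_smult_induced_hom_der)
qed

text \<open>Coefficients that come from an additive map \<open>M \<rightarrow> k\<close> give zero on the ideal, because the two
  exponents of a binomial in the ideal have the same degree.\<close>

lemma der_eq_zero:
  assumes \<chi>: "\<And>c. c \<in> tensor_rel \<Longrightarrow> pair \<chi> c = 0" and "f \<in> pres_ideal W"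
  shows "der u \<chi> f = 0"
  using assms(2)
proof (induction rule: pres_ideal_induct)
  case (add f c a b)
  have "kvec (zvec a - zvec b) \<in> tensor_rel"
    using add.hyps by (intro kvec_in_tensor_rel) (simp add: proj_diff mdeg_def)
  then have "nval \<chi> a - nval \<chi> b = 0"
    using \<chi> by (metis kvec_diff pair_diff)
  then show ?case
    using add by (simp add: der_add der_pres_ideal_mult[OF binomial_in_pres_ideal] der_binomial)
qed simp

text \<open>A derivation of degree \<open>u\<close> is trivial in \<open>T\<^sup>1\<close> if its coefficients agree on \<open>L\<^sub>k(W)\<close> with
  coefficients that are zero on \<open>W\<^sup>u\<close>. This means that they vanish on
  \<open>L\<^sub>k(W\<^sup>u) = L\<^sub>k(W) \<inter> k\<^bsup>W\<^sup>u\<^esup>\<close>: the annihilator of an intersection is the sum of the annihilators.\<close>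

lemma der_class_eq_iff:
  fixes W S :: "'m::ab_group_add set" and \<phi> \<psi> :: "'m \<Rightarrow> 'k::field"
  assumes gen: "generates W S" and W: "finite W"
    and s: "\<And>x y. s (x + y) = s x + s y" "\<And>x. keys (s x) \<subseteq> W" "\<And>x. proj (s x) = x"
  shows "der_class S W u \<phi> = der_class S W u \<psi> \<longleftrightarrow> (\<forall>c\<in>rel_space S W u. pair \<phi> c = pair \<psi> c)"
proof -
  let ?D = "der_submodule S W :: (('m, 'k) mpol set \<Rightarrow> 'm \<Rightarrow>\<^sub>0 'k) set"
  let ?\<delta> = "\<lambda>x. \<phi> x - \<psi> x"
  have "der_class S W u \<phi> = der_class S W u \<psi> \<longleftrightarrow> induced_hom W (der u ?\<delta>) \<in> ?D"
    by (simp add: der_class_def coset_eq_iff[OF add_subgroup_der_submodule[OF gen]]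
        induced_hom_der_diff)
  also have "\<dots> \<longleftrightarrow> (\<forall>c\<in>rel_space S W u. pair ?\<delta> c = 0)"
  proof
    assume "induced_hom W (der u ?\<delta>) \<in> ?D"
    then obtain \<chi> where \<chi>: "\<And>w. w \<in> excl S W u \<Longrightarrow> \<chi> w = 0"
      "\<And>a b. keys a \<subseteq> W \<Longrightarrow> keys b \<subseteq> W \<Longrightarrow> mdeg a = mdeg b \<Longrightarrow>
        lookup (induced_hom W (der u ?\<delta>) (coset (pres_ideal_sq W) (binomial a b))) (mdeg a + u) =
        pair \<chi> (kvec (zvec a - zvec b))"
      using der_submodule_binomial[OF gen W] by blast
    have eq: "pair (\<lambda>x. ?\<delta> x - \<chi> x) (kvec q) = 0" if q: "q \<in> int_rel W" for q
    proof -
      let ?p = "pos_part q" and ?n = "pos_part (- q)"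
      have pn: "keys ?p \<subseteq> W" "keys ?n \<subseteq> W" "mdeg ?p = mdeg ?n"
        using q keys_pos_part[of q] mdeg_pos_part_minus[of q] by (auto simp: int_rel_def)
      then have "nval ?\<delta> ?p - nval ?\<delta> ?n = pair \<chi> (kvec (zvec ?p - zvec ?n))"
        using \<chi>(2)[OF pn] by (simp add: induced_hom_der_coset binomial_in_pres_ideal der_binomial)
      then have "pair ?\<delta> (kvec (zvec ?p - zvec ?n)) = pair \<chi> (kvec (zvec ?p - zvec ?n))"
        by (simp only: kvec_diff pair_diff)
      then show ?thesis
        by (simp only: pos_part_diff pair_left_diff diff_self)
    qed
    show "\<forall>c\<in>rel_space S W u. pair ?\<delta> c = 0"
    proof
      fix c :: "'m \<Rightarrow>\<^sub>0 'k" assume c: "c \<in> rel_space S W u"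
      then have "c \<in> k_rel W" by (auto simp: rel_space_def k_rel_def excl_def)
      then have "c \<in> kvs.span (kvec ` int_rel W)"
        using k_rel_subset_span[where s = s, OF s] unfolding k_span_int_def by blast
      then have "pair (\<lambda>x. ?\<delta> x - \<chi> x) c = 0"
        by (rule pair_span_eq_0[rotated]) (auto simp: eq)
      moreover have "pair \<chi> c = pair (\<lambda>_. 0) c"
        using c \<chi>(1) by (intro pair_cong) (auto simp: rel_space_def k_rel_def)
      ultimately show "pair ?\<delta> c = 0" by (simp add: pair_left_diff) (simp add: pair_def)
    qed
  next
    assume zero: "\<forall>c\<in>rel_space S W u. pair ?\<delta> c = 0"
    let ?K = "{c :: 'm \<Rightarrow>\<^sub>0 'k. keys c \<subseteq> excl S W u}"
    obtain \<chi> where \<chi>: "\<And>c. c \<in> ?K \<Longrightarrow> pair \<chi> c = pair ?\<delta> c" "\<And>c. c \<in> tensor_rel \<Longrightarrow> pair \<chi> c = 0"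
      using linear_form_extend[OF subspace_keys[of "excl S W u"] subspace_tensor_rel, of "pair ?\<delta>"] zero
      by (auto simp: pair_add pair_kscale rel_space_def k_rel_def)
    have "\<chi> w = ?\<delta> w" if "w \<in> excl S W u" for w
      using \<chi>(1)[of "single w 1"] that by simp
    then have "induced_hom W (der u (\<lambda>x. ?\<delta> x - \<chi> x)) \<in> ?D"
      using W by (intro induced_der_in_der_submodule) auto
    moreover have "induced_hom W (der u ?\<delta>) = induced_hom W (der u (\<lambda>x. ?\<delta> x - \<chi> x))"
    proof (rule induced_hom_cong)
      fix f :: "('m, 'k) mpol" assume f: "f \<in> pres_ideal W"
      show "induced_hom W (der u ?\<delta>) (coset (pres_ideal_sq W) f) =
          induced_hom W (der u (\<lambda>x. ?\<delta> x - \<chi> x)) (coset (pres_ideal_sq W) f)"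
        using der_eq_zero[OF \<chi>(2) f, of u] f
          der_left_diff[of u ?\<delta> \<chi> f] by (simp add: induced_hom_der_coset)
    qed (simp add: induced_hom_def)
    ultimately show "induced_hom W (der u ?\<delta>) \<in> ?D" by simp
  qed
  finally show ?thesis by (simp add: pair_left_diff)
qed

section \<open>Linear forms on the quotients of relation spaces\<close>

definition rel_form ::
  "'m::ab_group_add set \<Rightarrow> 'm set \<Rightarrow> ('m \<Rightarrow> 'm \<Rightarrow>\<^sub>0 nat) \<Rightarrow> 'm \<Rightarrow> ('m \<Rightarrow> 'k::field) \<Rightarrow>
    ('m \<Rightarrow>\<^sub>0 'k) set \<Rightarrow> 'k" where
  "rel_form S E r u \<phi> = (\<lambda>X. if X \<in> quot (rel_space S E u) (rel_sub S E u)
     then the_elem ((\<lambda>c. pair \<phi> (subst r c)) ` X) else 0)"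

lemma rel_form_coset:
  fixes W S E :: "'m::ab_group_add set" and \<phi> :: "'m \<Rightarrow> 'k::field"
  assumes gen: "generates W S" and r: "expresses E W r" and \<phi>: "kills S W u \<phi>"
    and c: "c \<in> rel_space S E u"
  shows "rel_form S E r u \<phi> (coset (rel_sub S E u) c) = pair \<phi> (subst r c)"
proof -
  have "pair \<phi> (subst r d) = pair \<phi> (subst r c)" if "d \<in> coset (rel_sub S E u) c"
    for d :: "'m \<Rightarrow>\<^sub>0 'k"
  proof -
    have "subst r (d - c) \<in> rel_sub S W u"
      using that by (intro subst_rel_sub[OF gen r]) (simp add: mem_coset)
    then have "pair \<phi> (subst r (d - c)) = 0" using \<phi> by (simp add: kills_def)
    then show ?thesis by (simp add: subst_def lext_diff pair_diff)
  qed
  then show ?thesis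
    using c by (simp add: rel_form_def quot_def
        the_elem_image_coset[OF subspace_add_subgroup[OF subspace_rel_sub]])
qed

lemma quot_dual_coset:
  assumes l: "l \<in> quot_dual U V" and U: "kvs.subspace U" and V: "kvs.subspace V"
  shows "x \<in> U \<Longrightarrow> y \<in> U \<Longrightarrow> l (coset V (x + y)) = l (coset V x) + l (coset V y)"
    and "x \<in> U \<Longrightarrow> l (coset V (kscale m x)) = m * l (coset V x)"
proof -
  have V': "add_subgroup V" by (rule subspace_add_subgroup[OF V])
  have quot: "coset V x \<in> quot U V" if "x \<in> U" for x using that by (simp add: quot_def)
  show "l (coset V (x + y)) = l (coset V x) + l (coset V y)" if "x \<in> U" "y \<in> U"
    using l quot[OF that(1)] quot[OF that(2)]
    by (simp add: quot_dual_def qadd_coset[OF V', symmetric])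
  have "qmap V (kscale m) (coset V x) = coset V (kscale m x)"
    by (rule qmap_coset[OF V']) (auto simp: kvs.scale_right_distrib kvs.subspace_scale[OF V])
  then show "l (coset V (kscale m x)) = m * l (coset V x)" if "x \<in> U"
    using l quot[OF that] by (simp add: quot_dual_def flip: \<open>qmap V _ _ = _\<close>)
qed

lemma quot_dualI:
  assumes U: "kvs.subspace U" and V: "kvs.subspace V"
    and zero: "\<And>X. X \<notin> quot U V \<Longrightarrow> l X = 0"
    and add: "\<And>x y. x \<in> U \<Longrightarrow> y \<in> U \<Longrightarrow> l (coset V (x + y)) = l (coset V x) + l (coset V y)"
    and scale: "\<And>m x. x \<in> U \<Longrightarrow> l (coset V (kscale m x)) = m * l (coset V x)"
  shows "l \<in> quot_dual U V"
proof -
  have V': "add_subgroup V" by (rule subspace_add_subgroup[OF V])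
  have "qmap V (kscale m) (coset V x) = coset V (kscale m x)" for m x
    by (rule qmap_coset[OF V']) (auto simp: kvs.scale_right_distrib kvs.subspace_scale[OF V])
  then show ?thesis
    using zero add scale by (auto simp: quot_dual_def quot_def qadd_coset[OF V'])
qed

lemma rel_form_in_rel_dual:
  fixes W S E :: "'m::ab_group_add set" and \<phi> :: "'m \<Rightarrow> 'k::field"
  assumes gen: "generates W S" and r: "expresses E W r" and \<phi>: "kills S W u \<phi>"
  shows "rel_form S E r u \<phi> \<in> rel_dual S E u"
  unfolding rel_dual_def
proof (rule quot_dualI[OF subspace_rel_space subspace_rel_sub])
  note * = rel_form_coset[OF gen r \<phi>]
  show "rel_form S E r u \<phi> X = 0" if "X \<notin> quot (rel_space S E u) (rel_sub S E u)" for X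
    using that by (simp add: rel_form_def)
  fix x y :: "'m \<Rightarrow>\<^sub>0 'k" assume x: "x \<in> rel_space S E u"
  show "rel_form S E r u \<phi> (coset (rel_sub S E u) (kscale m x)) =
      m * rel_form S E r u \<phi> (coset (rel_sub S E u) x)" for m
    using x kvs.subspace_scale[OF subspace_rel_space x]
    by (simp add: * subst_def lext_kscale pair_kscale)
  assume y: "y \<in> rel_space S E u"
  show "rel_form S E r u \<phi> (coset (rel_sub S E u) (x + y)) =
      rel_form S E r u \<phi> (coset (rel_sub S E u) x) + rel_form S E r u \<phi> (coset (rel_sub S E u) y)"
    using x y kvs.subspace_add[OF subspace_rel_space x y]
    by (simp add: * subst_def lext_add pair_add)
qed

lemma pair_subst_subst:
  fixes W S E :: "'m::ab_group_add set" and \<phi> :: "'m \<Rightarrow> 'k::field"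
  assumes gen: "generates W S" and r: "expresses E W r" and r': "expresses W E r'"
    and \<phi>: "kills S W u \<phi>" and c: "c \<in> rel_space S W u"
  shows "pair \<phi> (subst r (subst r' c)) = pair \<phi> c"
proof -
  have "pair \<phi> (subst r (subst r' c) - c) = 0"
    using subst_subst[OF gen r' r c] \<phi> by (simp add: kills_def)
  then show ?thesis by (simp add: pair_diff)
qed

lemma rel_form_eq_iff:
  fixes W S E :: "'m::ab_group_add set" and \<phi> :: "'m \<Rightarrow> 'k::field"
  assumes gen: "generates W S" and genE: "generates E S"
    and r: "expresses E W r" and r': "expresses W E r'"
    and \<phi>: "kills S W u \<phi>" and \<psi>: "kills S W u \<psi>"
  shows "rel_form S E r u \<phi> = rel_form S E r u \<psi> \<longleftrightarrow> (\<forall>c\<in>rel_space S W u. pair \<phi> c = pair \<psi> c)"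
proof
  assume eq: "rel_form S E r u \<phi> = rel_form S E r u \<psi>"
  show "\<forall>c\<in>rel_space S W u. pair \<phi> c = pair \<psi> c"
  proof
    fix c :: "'m \<Rightarrow>\<^sub>0 'k" assume c: "c \<in> rel_space S W u"
    have "pair \<phi> (subst r (subst r' c)) = pair \<psi> (subst r (subst r' c))"
      using subst_rel_space[OF genE r' c] eq
        rel_form_coset[OF gen r \<phi>, of "subst r' c"] rel_form_coset[OF gen r \<psi>, of "subst r' c"]
      by simp
    then show "pair \<phi> c = pair \<psi> c"
      using c by (simp add: pair_subst_subst[OF gen r r' \<phi>] pair_subst_subst[OF gen r r' \<psi>])
  qed
next
  assume eq: "\<forall>c\<in>rel_space S W u. pair \<phi> c = pair \<psi> c"
  show "rel_form S E r u \<phi> = rel_form S E r u \<psi>"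
  proof
    fix X
    show "rel_form S E r u \<phi> X = rel_form S E r u \<psi> X"
    proof (cases "X \<in> quot (rel_space S E u) (rel_sub S E u)")
      case True
      then obtain c where c: "X = coset (rel_sub S E u) c" "c \<in> rel_space S E u"
        by (auto simp: quot_def)
      then show ?thesis
        using eq subst_rel_space[OF gen r c(2)]
        by (simp add: rel_form_coset[OF gen r \<phi>] rel_form_coset[OF gen r \<psi>])
    qed (simp add: rel_form_def)
  qed
qed

text \<open>A form \<open>l\<close> on the relations of \<open>E\<close> is pulled back to \<open>L\<^sub>k(W\<^sup>u)\<close> and then extended to coefficients
  on all of \<open>W\<close>.\<close>

lemma rel_form_surj:
  fixes W S E :: "'m::ab_group_add set" and l :: "('m \<Rightarrow>\<^sub>0 'k::field) set \<Rightarrow> 'k"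
  assumes gen: "generates W S" and genE: "generates E S"
    and r: "expresses E W r" and r': "expresses W E r'"
    and l: "l \<in> rel_dual S E u"
  obtains \<phi> where "kills S W u \<phi>" "rel_form S E r u \<phi> = l"
proof -
  let ?V = "rel_sub S E u :: ('m \<Rightarrow>\<^sub>0 'k) set"
  let ?f = "\<lambda>c. l (coset ?V (subst r' c))"
  note V = subspace_add_subgroup[OF subspace_rel_sub[of S E u, where 'a = 'k]]
  note dual = quot_dual_coset[OF l[unfolded rel_dual_def] subspace_rel_space subspace_rel_sub]
  have l0: "l (coset ?V 0) = 0"
    using dual(2)[of 0 0] kvs.subspace_0[OF subspace_rel_space[of S E u]] by simp
  have scale: "?f (kscale m x) = m * ?f x" if "x \<in> rel_space S W u" for m x
    using dual(2)[OF subst_rel_space[OF genE r' that]] by (simp add: subst_def lext_kscale)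
  have add: "?f (x + y) = ?f x + ?f y" if "x \<in> rel_space S W u" "y \<in> rel_space S W u" for x y
    using dual(1)[OF subst_rel_space[OF genE r' that(1)] subst_rel_space[OF genE r' that(2)]]
    by (simp add: subst_def lext_add)
  have zero: "?f x = 0" if "x \<in> {0}" for x
    using that l0 by (simp add: subst_def)
  obtain \<phi> where \<phi>: "\<And>c. c \<in> rel_space S W u \<Longrightarrow> pair \<phi> c = ?f c"
    using linear_form_extend[OF subspace_rel_space[of S W u] kvs.subspace_single_0, of ?f,
        OF add scale zero] by metis
  have kills: "kills S W u \<phi>"
    unfolding kills_def
  proof
    fix c :: "'m \<Rightarrow>\<^sub>0 'k" assume c: "c \<in> rel_sub S W u"
    have "coset ?V (subst r' c) = coset ?V 0"
      using subst_rel_sub[OF genE r' c] by (simp add: coset_eq_iff[OF V])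
    then show "pair \<phi> c = 0"
      using \<phi> c rel_sub_subset_rel_space[of S W u] l0 by auto
  qed
  have "rel_form S E r u \<phi> = l"
  proof
    fix X
    show "rel_form S E r u \<phi> X = l X"
    proof (cases "X \<in> quot (rel_space S E u) ?V")
      case True
      then obtain c where c: "X = coset ?V c" "c \<in> rel_space S E u"
        by (auto simp: quot_def)
      have "coset ?V (subst r' (subst r c)) = coset ?V c"
        using subst_subst[OF genE r r' c(2)] by (simp add: coset_eq_iff[OF V])
      then show ?thesis
        using c by (simp add: rel_form_coset[OF gen r kills] \<phi> subst_rel_space[OF gen r])
    next
      case False
      then show ?thesis
        using l by (simp add: rel_form_def rel_dual_def quot_dual_def)
    qed
  qed
  with kills show thesis by (rule that)
qed

lemma rel_dual_restrict_rel_form: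
  fixes W S E :: "'m::ab_group_add set" and \<phi> :: "'m \<Rightarrow> 'k::field"
  assumes gen: "generates W S" and genE: "generates E S" and r: "expresses E W r"
    and \<phi>: "kills S W u \<phi>" and w: "w \<in> S"
  shows "rel_dual_restrict S E u w (rel_form S E r u \<phi>) = rel_form S E r (u + w) \<phi>"
proof
  fix X :: "('m \<Rightarrow>\<^sub>0 'k) set"
  let ?Q = "quot (rel_space S E (u + w)) (rel_sub S E (u + w)) :: ('m \<Rightarrow>\<^sub>0 'k) set set"
  show "rel_dual_restrict S E u w (rel_form S E r u \<phi>) X = rel_form S E r (u + w) \<phi> X"
  proof (cases "X \<in> ?Q")
    case True
    then obtain c where c: "X = coset (rel_sub S E (u + w)) c" "c \<in> rel_space S E (u + w)"
      by (auto simp: quot_def)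
    have "d \<in> rel_space S E u" if "d \<in> X" for d
    proof -
      have "d - c \<in> rel_space S E (u + w)"
        using that c rel_sub_subset_rel_space by (auto simp: mem_coset)
      then have "d \<in> rel_space S E (u + w)"
        using kvs.subspace_add[OF subspace_rel_space _ c(2)] by fastforce
      then show ?thesis using rel_space_antimono[OF genE w] by auto
    qed
    then have "(\<lambda>q. rel_form S E r u \<phi> (coset (rel_sub S E u) q)) ` X =
        (\<lambda>c. pair \<phi> (subst r c)) ` X"
      by (intro image_cong) (auto simp: rel_form_coset[OF gen r \<phi>])
    then show ?thesis
      using True by (simp add: rel_dual_restrict_def rel_form_def)
  qed (simp add: rel_dual_restrict_def rel_form_def)
qed

section \<open>The degree \<open>u\<close> part of \<open>T\<^sup>1\<close>\<close>

text \<open>A class has many coefficient functions \<open>\<phi>\<close>. All of them give the same form.\<close>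

definition T1_form ::
  "'m::ab_group_add set \<Rightarrow> 'm set \<Rightarrow> 'm set \<Rightarrow> ('m \<Rightarrow> 'm \<Rightarrow>\<^sub>0 nat) \<Rightarrow> 'm \<Rightarrow>
    (('m, 'k::field) mpol set \<Rightarrow> ('m \<Rightarrow>\<^sub>0 'k)) set \<Rightarrow> ('m \<Rightarrow>\<^sub>0 'k) set \<Rightarrow> 'k" where
  "T1_form S E W r u t =
    rel_form S E r u (SOME \<phi>. kills S W u \<phi> \<and> t = der_class S W u \<phi>)"

theorem theorem3p3:
  fixes S E W :: "'m::ab_group_add set"
  assumes lattice: "\<exists>B :: 'm set. lattice_basis B"
    and monoid: "add_submonoid S"
    and spanning: "group_closure S = UNIV"
    and E: "finite E" "add_submonoid hull E = S"
    and presentation: "finite W" "add_submonoid hull W = S"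
  shows "\<exists>\<Phi> :: 'm \<Rightarrow> (('m, 'k::field) mpol set \<Rightarrow> ('m \<Rightarrow>\<^sub>0 'k)) set \<Rightarrow> (('m \<Rightarrow>\<^sub>0 'k) set \<Rightarrow> 'k).
    (\<forall>u. bij_betw (\<Phi> u) (T1_deg S W u) (rel_dual S E u) \<and>
         (\<forall>s\<in>T1_deg S W u. \<forall>t\<in>T1_deg S W u. \<Phi> u (T1_add S W s t) = \<Phi> u s + \<Phi> u t) \<and>
         (\<forall>c. \<forall>t\<in>T1_deg S W u.
            \<Phi> u (T1_smult S W (Poly_Mapping.single 0 c) t) = (\<lambda>X. c * \<Phi> u t X))) \<and>
    (\<forall>u. \<forall>w\<in>S.
         (rel_space S E (u + w) :: ('m \<Rightarrow>\<^sub>0 'k) set) \<subseteq> rel_space S E u \<and>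
         (rel_sub S E (u + w) :: ('m \<Rightarrow>\<^sub>0 'k) set) \<subseteq> rel_sub S E u \<and>
         (\<forall>t\<in>T1_deg S W u. T1_smult S W (chi w) t \<in> T1_deg S W (u + w) \<and>
            \<Phi> (u + w) (T1_smult S W (chi w) t) = rel_dual_restrict S E u w (\<Phi> u t)) \<and>
         (\<forall>t\<in>T1_deg S W u.
            (\<forall>q\<in>rel_space S E (u + w). \<Phi> u t (coset (rel_sub S E u) q) = 0) \<longrightarrow>
            T1_smult S W (chi w) t = T1_zero S W))"
proof -
  have genE: "generates E S" and gen: "generates W S"
    using add_submonoid_hull[OF E(2)] add_submonoid_hull[OF presentation(2)]
    by (simp_all add: generates_def)
  obtain r r' where r: "expresses E W r" and r': "expresses W E r'"
    using expresses_exists[OF genE gen] expresses_exists[OF gen genE] by metis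
  have "\<exists>c. keys c \<subseteq> W \<and> proj c = x" for x
  proof -
    have "x \<in> group_closure S" by (simp add: spanning)
    then show ?thesis
    proof induction
      case (base x)
      then have "x \<in> S" using zero_in_monoid[OF gen] by auto
      then obtain a where "x = mdeg a" "keys a \<subseteq> W" using gen by (auto simp: generates_def)
      then show ?case by (intro exI[of _ "zvec a"]) (simp add: mdeg_def)
    next
      case (diff x y)
      then obtain c d where "keys c \<subseteq> W" "proj c = x" "keys d \<subseteq> W" "proj d = y" by blast
      then show ?case by (intro exI[of _ "c - d"]) (simp add: proj_diff keys_diff_subset)
    qed
  qed
  then obtain s where s: "\<And>x y. s (x + y) = s x + s y" "\<And>x. keys (s x) \<subseteq> W" "\<And>x. proj (s x) = x"
    using lattice lattice_splitting[of _ W] by metis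
  let ?T = "\<lambda>u. T1_deg S W u :: (('m, 'k) mpol set \<Rightarrow> 'm \<Rightarrow>\<^sub>0 'k) set set"
  let ?\<Phi> = "T1_form S E W r :: 'm \<Rightarrow> (('m, 'k) mpol set \<Rightarrow> 'm \<Rightarrow>\<^sub>0 'k) set \<Rightarrow> ('m \<Rightarrow>\<^sub>0 'k) set \<Rightarrow> 'k"
  note class_eq = der_class_eq_iff[where s = s, OF gen presentation(1) s]
  note form_eq = rel_form_eq_iff[OF gen genE r r']
  have form: "?\<Phi> u (der_class S W u \<phi>) = rel_form S E r u \<phi>" if \<phi>: "kills S W u \<phi>" for u \<phi>
  proof -
    let ?P = "\<lambda>\<psi>. kills S W u \<psi> \<and> der_class S W u \<phi> = der_class S W u \<psi>"
    have "?P (SOME \<psi>. ?P \<psi>)" by (rule someI[of ?P \<phi>]) (simp add: \<phi>)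
    then have "rel_form S E r u \<phi> = rel_form S E r u (SOME \<psi>. ?P \<psi>)"
      using form_eq[OF \<phi>] class_eq[of u \<phi>] by blast
    then show ?thesis unfolding T1_form_def by simp
  qed
  have T1E: "\<exists>\<phi>. kills S W u \<phi> \<and> t = der_class S W u \<phi>" if "t \<in> ?T u" for u t
    using T1_degE[where s = s, OF gen s that] by blast
  note class_in = der_class_in_T1_deg[OF gen]
  note S0 = zero_in_monoid[OF gen]
  have bij: "bij_betw (?\<Phi> u) (?T u) (rel_dual S E u)" for u
    unfolding bij_betw_def
  proof
    show "inj_on (?\<Phi> u) (?T u)"
    proof (rule inj_onI)
      fix t t' assume t: "t \<in> ?T u" "t' \<in> ?T u" "?\<Phi> u t = ?\<Phi> u t'"
      obtain \<phi> \<psi> where "kills S W u \<phi>" "t = der_class S W u \<phi>" "kills S W u \<psi>" "t' = der_class S W u \<psi>"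
        using T1E[OF t(1)] T1E[OF t(2)] by blast
      then show "t = t'" using t(3) form form_eq class_eq by metis
    qed
    show "?\<Phi> u ` ?T u = rel_dual S E u"
    proof safe
      fix t assume "t \<in> ?T u"
      then show "?\<Phi> u t \<in> rel_dual S E u"
        using T1E[of t u] form rel_form_in_rel_dual[OF gen r] by metis
    next
      fix l :: "('m \<Rightarrow>\<^sub>0 'k) set \<Rightarrow> 'k" assume "l \<in> rel_dual S E u"
      then obtain \<phi> where "kills S W u \<phi>" "rel_form S E r u \<phi> = l"
        using rel_form_surj[OF gen genE r r'] by blast
      then show "l \<in> ?\<Phi> u ` ?T u" using form class_in by (metis imageI)
    qed
  qed
  \<comment> \<open>Choosing a representative of the coset makes linearity in \<open>\<phi>\<close> visible.\<close>
  have form_app: "rel_form S E r u \<phi> X = (if X \<in> quot (rel_space S E u) (rel_sub S E u)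
      then pair \<phi> (subst r (SOME c. c \<in> rel_space S E u \<and> X = coset (rel_sub S E u) c)) else 0)"
    if "kills S W u \<phi>" for u and \<phi> :: "'m \<Rightarrow> 'k" and X
  proof (cases "X \<in> quot (rel_space S E u) (rel_sub S E u)")
    case True
    then have "\<exists>c. c \<in> rel_space S E u \<and> X = coset (rel_sub S E u) c" by (auto simp: quot_def)
    from someI_ex[OF this] show ?thesis
      using True rel_form_coset[OF gen r that] by metis
  qed (simp add: rel_form_def)
  have add: "?\<Phi> u (T1_add S W t t') = ?\<Phi> u t + ?\<Phi> u t'" if t: "t \<in> ?T u" "t' \<in> ?T u" for u t t'
  proof -
    obtain \<phi> \<psi> where *: "kills S W u \<phi>" "t = der_class S W u \<phi>" "kills S W u \<psi>" "t' = der_class S W u \<psi>"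
      using T1E[OF t(1)] T1E[OF t(2)] by blast
    then show ?thesis
      by (auto simp: T1_add_der_class[OF gen] form kills_add form_app pair_left_add)
  qed
  have smult: "?\<Phi> u (T1_smult S W (single 0 c) t) = (\<lambda>X. c * ?\<Phi> u t X)" if t: "t \<in> ?T u" for u c t
  proof -
    obtain \<phi> where *: "kills S W u \<phi>" "t = der_class S W u \<phi>"
      using T1E[OF t] by blast
    then show ?thesis
      by (auto simp: T1_smult_der_class[OF gen S0] form kills_mult form_app pair_left_mult)
  qed
  have chi: "T1_smult S W (chi w) t \<in> ?T (u + w) \<and>
      ?\<Phi> (u + w) (T1_smult S W (chi w) t) = rel_dual_restrict S E u w (?\<Phi> u t)"
    if w: "w \<in> S" and t: "t \<in> ?T u" for u w t
  proof -
    obtain \<phi> where \<phi>: "kills S W u \<phi>" "t = der_class S W u \<phi>"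
      using T1E[OF t] by blast
    note \<phi>' = kills_mono[OF gen w \<phi>(1)]
    have "T1_smult S W (chi w) t = der_class S W (u + w) \<phi>"
      using \<phi>(2) by (simp add: T1_smult_der_class[OF gen w])
    then show ?thesis
      using \<phi> by (simp add: class_in[OF \<phi>'] form[OF \<phi>'] form[OF \<phi>(1)]
          rel_dual_restrict_rel_form[OF gen genE r \<phi>(1) w])
  qed
  have annihilate: "T1_smult S W (chi w) t = T1_zero S W"
    if w: "w \<in> S" and t: "t \<in> ?T u"
      and zero: "\<forall>q\<in>rel_space S E (u + w). ?\<Phi> u t (coset (rel_sub S E u) q) = 0" for u w t
  proof -
    obtain \<phi> where \<phi>: "kills S W u \<phi>" "t = der_class S W u \<phi>"
      using T1E[OF t] by blast
    have eq: "T1_smult S W (chi w) t = der_class S W (u + w) \<phi>"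
      using \<phi>(2) by (simp add: T1_smult_der_class[OF gen w])
    note \<phi>' = kills_mono[OF gen w \<phi>(1)]
    have "pair \<phi> c = pair (\<lambda>_. 0) c" if c: "c \<in> rel_space S W (u + w)" for c
    proof -
      have c': "subst r' c \<in> rel_space S E (u + w)"
        by (rule subst_rel_space[OF genE r' c])
      then have "pair \<phi> (subst r (subst r' c)) = 0"
        using zero rel_space_antimono[OF genE w, of u] \<phi>
        by (force simp: form rel_form_coset[OF gen r \<phi>(1)])
      then show ?thesis
        using pair_subst_subst[OF gen r r' \<phi>' c] by (simp add: pair_def)
    qed
    then have "der_class S W (u + w) \<phi> = der_class S W (u + w) (\<lambda>_. 0)"
      using class_eq by blast
    also have "\<dots> = T1_zero S W"
    proof -
      have "0 = induced_hom W (der (u + w) (\<lambda>_. 0 :: 'k))"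
        by (rule induced_hom_cong) (simp_all add: induced_hom_der_coset der_def pair_def)
      then show ?thesis by (simp add: der_class_def)
    qed
    finally show ?thesis using eq by simp
  qed
  show ?thesis
    using bij add smult chi annihilate rel_space_antimono[OF genE] rel_sub_antimono[OF genE]
    by (intro exI[of _ ?\<Phi>]) blast
qed

end
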